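(* Let $H$ be a real separable Hilbert space and let $R:H\to H$ be a bounded linear self-adjoint operator. For any $k\in\mathbb{N}=\{1,2,\ldots\}$, if $\varphi\in\mathrm{BUC}^k(H)$ then $\varphi\in\mathrm{BUC}^k_R(H)$ (and so $\varphi\in\mathrm{BUC}^k_{H_R}(H)$), and for any $x\in H$ and $k\ge2$ it holds $$\nabla^k_{H_R}\varphi(x)(h_1,\ldots,h_{k-1})=R^2\nabla^k\varphi(x)(h_1,\ldots,h_{k-1}),\qquad h_1,\ldots,h_{k-1}\in H_R,$$ $$\nabla^k_R\varphi(x)(v_1,\ldots,v_{k-1})=R\nabla^k\varphi(x)(Rv_1,\ldots,Rv_{k-1}),\qquad v_1,\ldots,v_{k-1}\in H.$$ Furthermore, if $k=1$, for any $x\in H$, $$\nabla_{H_R}\varphi(x)=R^2\nabla\varphi(x)\qquad\text{and}\qquad\nabla_R\varphi(x)=R\nabla\varphi(x).$$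
   Context: Multilinear maps: for Banach spaces $K_1,K_2$ and $k\ge1$, $\mathcal{L}^{(k)}(K_1;K_2)$ is the space of continuous $k$-linear maps $K_1^k\to K_2$ with its usual norm; $\mathcal{L}^{(k)}(K_1):=\mathcal{L}^{(k)}(K_1;K_1)$, $\mathcal{L}^{(0)}(K_1):=K_1$. $\mathrm{BUC}(K_1;K_2)$ is the space of bounded uniformly continuous functions; $\mathrm{BUC}(K_1):=\mathrm{BUC}(K_1;\mathbb{R})$. The space $H_R$: $H_R:=R(H)$, $R^{-1}:=(R_{|(\ker R)^\perp})^{-1}:H_R\to(\ker R)^\perp$, and $H_R$ is a separable Hilbert space with $\langle x,y\rangle_{H_R}:=\langle R^{-1}x,R^{-1}y\rangle_H$; it is continuously embedded in $H$. Differentiability along $H_0$, where $H_0$ is either $H_R$ or $H$: for a Banach space $Y$, $f:H\to Y$ is $H_0$-Fréchet differentiable at $x\in H$ if there is a (unique) $L_x\in\mathcal{L}(H_0;Y)$ with $\lim_{\|h\|_{H_0}\to0}\|f(x+h)-f(x)-L_xh\|_Y/\|h\|_{H_0}=0$; write $\mathcal{D}_{H_0}f(x):=L_x$. Higher orders are defined inductively ($f$ is twice $H_0$-Fréchet differentiable if $\mathcal{D}_{H_0}f:H\to\mathcal{L}(H_0;Y)$ is $H_0$-Fréchet differentiable, with $\mathcal{D}^2_{H_0}f(x)(h,k):=\mathcal{D}_{H_0}(\mathcal{D}_{H_0}f(x)h)k$, and so on), giving $\mathcal{D}^k_{H_0}f(x)\in\mathcal{L}^{(k)}(H_0;Y)$.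 For real-valued $f$, $\nabla^k_{H_0}f(x)\in\mathcal{L}^{(k-1)}(H_0)$ is the unique element with $\mathcal{D}^k_{H_0}f(x)(h_1,\ldots,h_k)=\langle\nabla^k_{H_0}f(x)(h_1,\ldots,h_{k-1}),h_k\rangle_{H_0}$ for all $h_i\in H_0$ (for $k=1$, $\nabla_{H_0}f(x)\in H_0$). $\mathrm{BUC}^k_{H_0}(H)$ is the space of $k$-times $H_0$-Fréchet differentiable $f\in\mathrm{BUC}(H)$ such that $\nabla^i_{H_0}f\in\mathrm{BUC}(H;\mathcal{L}^{(i-1)}(H_0))$ for $i=1,\ldots,k$. When $H_0=H$ one writes $\nabla^k f$ and $\mathrm{BUC}^k(H)$. $R$-differentiability: $f:H\to\mathbb{R}$ is $R$-differentiable at $x\in H$ if there is $l_x\in H$ such that for all $v\in H$, $\lim_{s\to0}|\frac{f(x+sRv)-f(x)}{s}-\langle l_x,v\rangle_H|=0$; $\nabla_Rf(x):=l_x$. Inductively, for $k\ge1$, $f$ is $(k+1)$-times $R$-differentiable at $x$ if it is $k$-times $R$-differentiable and there is a unique $B_x\in\mathcal{L}^{(k)}(H)$ such that for all $v\in H$, $\frac{\nabla^k_Rf(x+sRv)-\nabla^k_Rf(x)}{s}\to B_x(\cdot,\ldots,\cdot,v)$ in $\mathcal{L}^{(k-1)}(H)$ as $s\to0$; $\nabla^{k+1}_Rf(x):=B_x$. $\mathrm{BUC}^k_R(H)$ is the space of $k$-times $R$-differentiable $f\in\mathrm{BUC}(H)$ with $\nabla^i_Rf\in\mathrm{BUC}(H;\mathcal{L}^{(i-1)}(H))$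 for $i=1,\ldots,k$. *)

theory Defs
  imports "HOL-Analysis.Analysis" "HOL-Library.Function_Algebras"
begin

text \<open>
  The space \<open>H\<^sub>R = R(H)\<close> depends on the operator \<open>R\<close> and the spaces of \<open>k\<close>-linear maps depend
  on the number \<open>k\<close>, so neither can be a type. They are given by a carrier and a norm; the
  vector operations are those of the ambient type.
\<close>

record 'a normed_sp =
  carr :: "'a set"
  nrm :: "'a \<Rightarrow> real"

record 'a hilbert_sp = "'a normed_sp" +
  ip :: "'a \<Rightarrow> 'a \<Rightarrow> real"

definition real_sp :: "real normed_sp" where
  "real_sp = \<lparr>carr = UNIV, nrm = norm\<rparr>"

definition whole_sp :: "'a::real_inner hilbert_sp" where
  "whole_sp = \<lparr>carr = UNIV, nrm = norm, ip = inner\<rparr>"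

definition R_inv :: "('a::real_inner \<Rightarrow> 'a) \<Rightarrow> 'a \<Rightarrow> 'a" where
  "R_inv R = inv_into ({x. R x = 0}\<^sup>\<bottom>) R"

definition range_sp :: "('a::real_inner \<Rightarrow> 'a) \<Rightarrow> 'a hilbert_sp" where
  "range_sp R = \<lparr>carr = range R,
                 nrm = (\<lambda>x. sqrt (R_inv R x \<bullet> R_inv R x)),
                 ip = (\<lambda>x y. R_inv R x \<bullet> R_inv R y)\<rparr>"

instantiation "fun" :: (type, real_vector) real_vector
begin

definition scaleR_fun :: "real \<Rightarrow> ('a \<Rightarrow> 'b) \<Rightarrow> 'a \<Rightarrow> 'b" where
  "scaleR_fun c f = (\<lambda>x. c *\<^sub>R f x)"

instance
  by standard (simp_all add: scaleR_fun_def fun_eq_iff scaleR_add_right scaleR_add_left)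

end

text \<open>
  Maps are required to vanish outside their domain, so that they form a vector space under the
  pointwise operations and are determined by their values on the domain. Continuity is expressed
  by boundedness, as for \<^const>\<open>bounded_linear\<close>.
\<close>

definition lin_maps ::
  "('a::real_vector, 'm) normed_sp_scheme \<Rightarrow> ('y::real_vector, 'n) normed_sp_scheme \<Rightarrow> ('a \<Rightarrow> 'y) set"
where
  "lin_maps V Y = {L.
     (\<forall>h\<in>carr V. L h \<in> carr Y) \<and>
     (\<forall>h. h \<notin> carr V \<longrightarrow> L h = 0) \<and>
     (\<forall>g\<in>carr V. \<forall>h\<in>carr V. L (g + h) = L g + L h) \<and>
     (\<forall>c. \<forall>h\<in>carr V. L (c *\<^sub>R h) = c *\<^sub>R L h) \<and>
     (\<exists>C. \<forall>h\<in>carr V. nrm Y (L h) \<le> C * nrm V h)}"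

text \<open>
  A \<open>k\<close>-linear map takes the list of its \<open>k\<close> arguments. For \<open>k = 0\<close> the only argument list is
  \<open>[]\<close>, and the map is identified with its value there.
\<close>

definition args :: "nat \<Rightarrow> ('a, 'm) normed_sp_scheme \<Rightarrow> 'a list set" where
  "args k V = {hs. length hs = k \<and> set hs \<subseteq> carr V}"

definition mlin_maps ::
  "nat \<Rightarrow> ('a::real_vector, 'm) normed_sp_scheme \<Rightarrow> ('b::real_vector, 'n) normed_sp_scheme \<Rightarrow>
   ('a list \<Rightarrow> 'b) set"
where
  "mlin_maps k V W = {B.
     (\<forall>hs\<in>args k V. B hs \<in> carr W) \<and>
     (\<forall>hs. hs \<notin> args k V \<longrightarrow> B hs = 0) \<and>
     (\<forall>hs\<in>args k V. \<forall>i<k. \<forall>g\<in>carr V. \<forall>h\<in>carr V.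
        B (hs[i := g + h]) = B (hs[i := g]) + B (hs[i := h])) \<and>
     (\<forall>hs\<in>args k V. \<forall>i<k. \<forall>c. \<forall>h\<in>carr V.
        B (hs[i := c *\<^sub>R h]) = c *\<^sub>R B (hs[i := h])) \<and>
     (\<exists>C. \<forall>hs\<in>args k V. nrm W (B hs) \<le> C * prod_list (map (nrm V) hs))}"

definition mlin_norm ::
  "nat \<Rightarrow> ('a, 'm) normed_sp_scheme \<Rightarrow> ('b, 'n) normed_sp_scheme \<Rightarrow> ('a list \<Rightarrow> 'b) \<Rightarrow> real"
where
  "mlin_norm k V W B = (SUP hs\<in>{hs \<in> args k V. \<forall>h\<in>set hs. nrm V h \<le> 1}. nrm W (B hs))"

definition mlin_sp ::
  "nat \<Rightarrow> ('a::real_vector, 'm) normed_sp_scheme \<Rightarrow> ('b::real_vector, 'n) normed_sp_scheme \<Rightarrow>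
   ('a list \<Rightarrow> 'b) normed_sp"
where
  "mlin_sp k V W = \<lparr>carr = mlin_maps k V W, nrm = mlin_norm k V W\<rparr>"

definition const_map :: "'b::zero \<Rightarrow> 'a list \<Rightarrow> 'b" where
  "const_map b = (\<lambda>hs. if hs = [] then b else 0)"

definition BUC :: "('y::real_vector, 'n) normed_sp_scheme \<Rightarrow> ('a::real_normed_vector \<Rightarrow> 'y) set"
where
  "BUC Y = {F.
     (\<forall>x. F x \<in> carr Y) \<and>
     (\<exists>M. \<forall>x. nrm Y (F x) \<le> M) \<and>
     (\<forall>e>0. \<exists>d>0. \<forall>x y. dist x y < d \<longrightarrow> nrm Y (F x - F y) < e)}"

text \<open>The filter below describes \<open>\<parallel>h\<parallel>\<^sub>V \<rightarrow> 0\<close> with \<open>0 \<noteq> h \<in> V\<close>.\<close>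

definition has_fderiv_along ::
  "('a::real_vector, 'm) normed_sp_scheme \<Rightarrow> ('y::real_vector, 'n) normed_sp_scheme \<Rightarrow>
   ('a \<Rightarrow> 'y) \<Rightarrow> 'a \<Rightarrow> ('a \<Rightarrow> 'y) \<Rightarrow> bool"
where
  "has_fderiv_along V Y F x L \<longleftrightarrow>
     L \<in> lin_maps V Y \<and>
     ((\<lambda>h. nrm Y (F (x + h) - F x - L h) / nrm V h) \<longlongrightarrow> 0)
       (inf (filtercomap (nrm V) (at 0)) (principal (carr V)))"

definition fderiv_along ::
  "('a::real_vector, 'm) normed_sp_scheme \<Rightarrow> ('y::real_vector, 'n) normed_sp_scheme \<Rightarrow>
   ('a \<Rightarrow> 'y) \<Rightarrow> 'a \<Rightarrow> ('a \<Rightarrow> 'y)"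
where
  "fderiv_along V Y F x = (THE L. has_fderiv_along V Y F x L)"

text \<open>
  The derivative of order \<open>k + 1\<close> is the derivative of \<open>D\<^sup>k f\<close>, whose values are \<open>k\<close>-linear forms;
  the new direction is the last argument.
\<close>

primrec fderiv_pow ::
  "('a::real_vector, 'm) normed_sp_scheme \<Rightarrow> nat \<Rightarrow> ('a \<Rightarrow> real) \<Rightarrow> 'a \<Rightarrow> 'a list \<Rightarrow> real"
where
  "fderiv_pow V 0 f = (\<lambda>x. const_map (f x))"
| "fderiv_pow V (Suc k) f = (\<lambda>x hs. if hs = [] then 0
     else fderiv_along V (mlin_sp k V real_sp) (fderiv_pow V k f) x (last hs) (butlast hs))"

primrec fdifferentiable_times ::
  "('a::real_vector, 'm) normed_sp_scheme \<Rightarrow> nat \<Rightarrow> ('a \<Rightarrow> real) \<Rightarrow> bool"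
where
  "fdifferentiable_times V 0 f = True"
| "fdifferentiable_times V (Suc k) f \<longleftrightarrow>
     fdifferentiable_times V k f \<and>
     (\<forall>x. \<exists>L. has_fderiv_along V (mlin_sp k V real_sp) (fderiv_pow V k f) x L)"

text \<open>\<open>nabla V k f x\<close> is meaningful for \<open>k \<ge> 1\<close> only.\<close>

definition nabla ::
  "'a::real_vector hilbert_sp \<Rightarrow> nat \<Rightarrow> ('a \<Rightarrow> real) \<Rightarrow> 'a \<Rightarrow> 'a list \<Rightarrow> 'a"
where
  "nabla V k f x = (THE G. G \<in> mlin_maps (k - 1) V V \<and>
     (\<forall>hs\<in>args (k - 1) V. \<forall>h\<in>carr V. fderiv_pow V k f x (hs @ [h]) = ip V (G hs) h))"

definition grad :: "'a::real_vector hilbert_sp \<Rightarrow> ('a \<Rightarrow> real) \<Rightarrow> 'a \<Rightarrow> 'a" where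
  "grad V f x = nabla V 1 f x []"

definition BUC_diff :: "'a::real_normed_vector hilbert_sp \<Rightarrow> nat \<Rightarrow> ('a \<Rightarrow> real) set" where
  "BUC_diff V k = {f \<in> BUC real_sp. fdifferentiable_times V k f \<and>
     (\<forall>i\<in>{1..k}. nabla V i f \<in> BUC (mlin_sp (i - 1) V V))}"

definition has_R_grad ::
  "('a::real_inner \<Rightarrow> 'a) \<Rightarrow> ('a \<Rightarrow> real) \<Rightarrow> 'a \<Rightarrow> 'a \<Rightarrow> bool"
where
  "has_R_grad R f x l \<longleftrightarrow>
     (\<forall>v. ((\<lambda>s. \<bar>(f (x + s *\<^sub>R R v) - f x) / s - l \<bullet> v\<bar>) \<longlongrightarrow> 0) (at 0))"

definition R_grad :: "('a::real_inner \<Rightarrow> 'a) \<Rightarrow> ('a \<Rightarrow> real) \<Rightarrow> 'a \<Rightarrow> 'a" where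
  "R_grad R f x = (THE l. has_R_grad R f x l)"

text \<open>
  \<open>F\<close> takes values in the space of \<open>(k - 1)\<close>-linear maps, and \<open>B\<close> is the candidate for the next
  derivative of \<open>F\<close> at \<open>x\<close>, a \<open>k\<close>-linear map.
\<close>

definition has_R_deriv ::
  "('a::real_inner \<Rightarrow> 'a) \<Rightarrow> nat \<Rightarrow> ('a \<Rightarrow> 'a list \<Rightarrow> 'a) \<Rightarrow> 'a \<Rightarrow> ('a list \<Rightarrow> 'a) \<Rightarrow> bool"
where
  "has_R_deriv R k F x B \<longleftrightarrow>
     B \<in> mlin_maps k whole_sp whole_sp \<and>
     (\<forall>v. ((\<lambda>s. mlin_norm (k - 1) whole_sp whole_sp
                  ((1 / s) *\<^sub>R (F (x + s *\<^sub>R R v) - F x) - (\<lambda>vs. B (vs @ [v])))) \<longlongrightarrow> 0) (at 0))"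

text \<open>The value at \<open>0\<close> is a dummy: \<open>\<nabla>\<^sub>R\<^sup>k\<close> is defined for \<open>k \<ge> 1\<close> only.\<close>

fun R_nabla :: "('a::real_inner \<Rightarrow> 'a) \<Rightarrow> nat \<Rightarrow> ('a \<Rightarrow> real) \<Rightarrow> 'a \<Rightarrow> 'a list \<Rightarrow> 'a" where
  "R_nabla R 0 f = (\<lambda>x hs. 0)"
| "R_nabla R (Suc 0) f = (\<lambda>x. const_map (R_grad R f x))"
| "R_nabla R (Suc (Suc k)) f = (\<lambda>x. THE B. has_R_deriv R (Suc k) (R_nabla R (Suc k) f) x B)"

fun R_differentiable_times :: "('a::real_inner \<Rightarrow> 'a) \<Rightarrow> nat \<Rightarrow> ('a \<Rightarrow> real) \<Rightarrow> bool" where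
  "R_differentiable_times R 0 f \<longleftrightarrow> True"
| "R_differentiable_times R (Suc 0) f \<longleftrightarrow> (\<forall>x. \<exists>l. has_R_grad R f x l)"
| "R_differentiable_times R (Suc (Suc k)) f \<longleftrightarrow>
     R_differentiable_times R (Suc k) f \<and>
     (\<forall>x. \<exists>!B. has_R_deriv R (Suc k) (R_nabla R (Suc k) f) x B)"

definition BUC_R :: "('a::real_inner \<Rightarrow> 'a) \<Rightarrow> nat \<Rightarrow> ('a \<Rightarrow> real) set" where
  "BUC_R R k = {f \<in> BUC real_sp. R_differentiable_times R k f \<and>
     (\<forall>i\<in>{1..k}. R_nabla R i f \<in> BUC (mlin_sp (i - 1) whole_sp whole_sp))}"

end

theory Submission
  imports Defs
begin

text \<open>
  Let \<open>D\<^sup>i\<close> be the \<open>i\<close>-th derivative of \<open>\<phi>\<close> along \<open>H\<close>, an \<open>i\<close>-linear form in which the latest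
  direction of differentiation is the last argument. Every element of the range of \<open>R\<close> is \<open>R u\<close> with
  \<open>u\<close> orthogonal to the kernel (\<open>translate_meets_orthogonal_comp\<close>, from the existence of points of
  least norm), so \<open>range_sp R\<close> is a normed space included in \<open>H\<close> by a bounded map. A remainder that is
  small compared with the norm of \<open>H\<close> is therefore small compared with the norm of \<open>range_sp R\<close>, and
  the derivatives along \<open>range_sp R\<close> are the restrictions of the \<open>D\<^sup>i\<close>
  (\<open>has_fderiv_along_restrict\<close>, \<open>fderiv_pow_range\<close>). For \<open>h = R u\<close> as above the inner product of
  \<open>R (R v)\<close> with \<open>h\<close> in \<open>range_sp R\<close> is \<open>R v \<bullet> u = v \<bullet> h\<close>, because \<open>R\<close> is self-adjoint. This gives
  the factor \<open>R\<^sup>2\<close> in the gradients along \<open>range_sp R\<close> (\<open>nabla_range\<close>). The gradients along \<open>H\<close>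
  represent the forms \<open>D\<^sup>i\<close> by Riesz representation (\<open>riesz_multilinear\<close>, \<open>nabla_whole\<close>).

  For the \<open>R\<close>-derivatives, the candidate of order \<open>k + 1\<close> is
  \<open>S\<^sub>k(v\<^sub>1,\<dots>,v\<^sub>k) = R \<nabla>\<^sup>k\<^sup>+\<^sup>1\<phi>(R v\<^sub>1,\<dots>,R v\<^sub>k)\<close>, and one shows by induction that it is the \<open>R\<close>-derivative of
  \<open>S\<^sub>k\<^sub>-\<^sub>1\<close> (\<open>has_R_deriv_nabla\<close>, \<open>R_nabla_eq\<close>). Paired with a vector \<open>w\<close>, the gradient \<open>S\<^sub>k\<close> is the form
  \<open>D\<^sup>k\<^sup>+\<^sup>1(R v\<^sub>1,\<dots>,R v\<^sub>k,R w)\<close>. The value of a gradient thus occupies the place of the latest direction,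
  whereas differentiating \<open>S\<^sub>k\<^sub>-\<^sub>1\<close> in the direction \<open>R v\<^sub>k\<close> puts this direction after \<open>R w\<close>. So the
  claim rests on the symmetry of \<open>D\<^sup>k\<^sup>+\<^sup>1\<close> in its last two arguments (\<open>fderiv_pow_swap_last\<close>), that is,
  on the equality of mixed second derivatives of a real function, applied to \<open>D\<^sup>k\<^sup>-\<^sup>1\<close> with its
  arguments fixed. Membership in the spaces of bounded uniformly continuous derivatives is inherited
  because all these passages are bounded linear maps on spaces of multilinear maps, of the common
  form \<open>pull\<close>.
\<close>

section \<open>Orthogonal projection and Riesz representation\<close>

text \<open>
  A minimising sequence for the norm is Cauchy: by the parallelogram identity two points
  of the convex set whose norms are nearly minimal have a midpoint of nearly minimal norm, which
  leaves no room for their distance.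
\<close>

lemma closed_convex_has_min_norm:
  fixes C :: "'a::{real_inner, complete_space} set"
  assumes "closed C" "convex C" "C \<noteq> {}"
  shows "\<exists>p\<in>C. \<forall>x\<in>C. norm p \<le> norm x"
proof -
  define d where "d = Inf ((\<lambda>x. (norm x)\<^sup>2) ` C)"
  have bdd: "bdd_below ((\<lambda>x. (norm x)\<^sup>2) ` C)"
    by (rule bdd_belowI[of _ 0]) auto
  have d_le: "d \<le> (norm x)\<^sup>2" if "x \<in> C" for x
    unfolding d_def using that bdd by (rule cINF_lower[rotated])
  have "\<exists>x\<in>C. (norm x)\<^sup>2 < d + 1 / real (Suc n)" for n
  proof -
    have "Inf ((\<lambda>x. (norm x)\<^sup>2) ` C) < d + 1 / real (Suc n)"
      unfolding d_def by simp
    then show ?thesis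
      using cInf_less_iff[OF _ bdd] assms(3) by auto
  qed
  then obtain X where X: "\<And>n. X n \<in> C" "\<And>n. (norm (X n))\<^sup>2 < d + 1 / real (Suc n)"
    by metis
  have dist_sq: "(norm (X m - X n))\<^sup>2 \<le> 2 / real (Suc m) + 2 / real (Suc n)" for m n
  proof -
    have "(1/2) *\<^sub>R X m + (1/2) *\<^sub>R X n \<in> C"
      using assms(2) X(1) by (intro convexD) auto
    then have "d \<le> (norm ((1/2) *\<^sub>R X m + (1/2) *\<^sub>R X n))\<^sup>2"
      by (rule d_le)
    then have "4 * d \<le> (norm (X m))\<^sup>2 + (norm (X n))\<^sup>2 + 2 * (X m \<bullet> X n)"
      by (simp add: power2_norm_eq_inner inner_add inner_diff inner_commute)
    moreover have "(norm (X m - X n))\<^sup>2 = (norm (X m))\<^sup>2 + (norm (X n))\<^sup>2 - 2 * (X m \<bullet> X n)"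
      by (simp add: power2_norm_eq_inner inner_add inner_diff inner_commute)
    ultimately show ?thesis
      using X(2)[of m] X(2)[of n] by linarith
  qed
  have "Cauchy X"
  proof (rule metric_CauchyI)
    fix e :: real assume "e > 0"
    then obtain N where N: "1 / real (Suc N) < e\<^sup>2 / 4"
      using nat_approx_posE[of "e\<^sup>2 / 4"] by auto
    have "dist (X m) (X n) < e" if "m \<ge> N" "n \<ge> N" for m n
    proof -
      have "1 / real (Suc m) \<le> 1 / real (Suc N)" "1 / real (Suc n) \<le> 1 / real (Suc N)"
        using that by (auto simp: frac_le)
      then have "(norm (X m - X n))\<^sup>2 < e\<^sup>2"
        using dist_sq[of m n] N by simp
      then show ?thesis
        using \<open>e > 0\<close> by (simp add: dist_norm power2_less_imp_less)
    qed
    then show "\<exists>M. \<forall>m\<ge>M. \<forall>n\<ge>M. dist (X m) (X n) < e" by blast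
  qed
  then obtain p where p: "X \<longlonglongrightarrow> p"
    using Cauchy_convergent_iff convergent_def by blast
  have "p \<in> C"
    using assms(1) X(1) p closed_sequentially by blast
  have "(\<lambda>n. (norm (X n))\<^sup>2) \<longlonglongrightarrow> (norm p)\<^sup>2"
    using p by (intro tendsto_intros)
  moreover have "(\<lambda>n. d + 1 / real (Suc n)) \<longlonglongrightarrow> d + 0"
    by (intro tendsto_intros LIMSEQ_Suc[OF lim_1_over_n])
  ultimately have "(norm p)\<^sup>2 \<le> d"
    using X(2) by (intro LIMSEQ_le[of "\<lambda>n. (norm (X n))\<^sup>2"]) (auto intro: less_imp_le)
  then have "norm p \<le> norm x" if "x \<in> C" for x
    using d_le[OF that] by (meson norm_ge_zero order_trans power2_le_imp_le)
  with \<open>p \<in> C\<close> show ?thesis by blast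
qed

text \<open>The point of least norm in the affine subspace \<open>a + S\<close> is orthogonal to \<open>S\<close>.\<close>

lemma translate_meets_orthogonal_comp:
  fixes S :: "'a::{real_inner, complete_space} set"
  assumes "closed S" "subspace S"
  shows "\<exists>p. p - a \<in> S \<and> p \<in> S\<^sup>\<bottom>"
proof -
  have "closed ((+) a ` S)" "convex ((+) a ` S)" "(+) a ` S \<noteq> {}"
    using assms subspace_0[OF assms(2)] closed_translation subspace_imp_convex convex_translation by auto
  then obtain p where p: "p \<in> (+) a ` S" "\<And>x. x \<in> (+) a ` S \<Longrightarrow> norm p \<le> norm x"
    using closed_convex_has_min_norm by metis
  have pS: "p - a \<in> S" using p(1) by auto
  have "s \<bullet> p = 0" if "s \<in> S" for s
  proof (cases "s = 0")
    case False
    define t where "t = - (p \<bullet> s) / (s \<bullet> s)"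
    have "(p - a) + t *\<^sub>R s \<in> S"
      using assms(2) pS that by (simp add: subspace_add subspace_scale)
    then have "p + t *\<^sub>R s \<in> (+) a ` S"
      by (auto simp: image_iff algebra_simps intro!: bexI[of _ "(p - a) + t *\<^sub>R s"])
    then have "(norm p)\<^sup>2 \<le> (norm (p + t *\<^sub>R s))\<^sup>2"
      by (intro power_mono p(2)) auto
    also have "\<dots> = (norm p)\<^sup>2 + 2 * t * (p \<bullet> s) + t\<^sup>2 * (s \<bullet> s)"
      unfolding power2_norm_eq_inner
      by (simp add: inner_simps inner_commute power2_eq_square algebra_simps)
    also have "\<dots> = (norm p)\<^sup>2 - (p \<bullet> s)\<^sup>2 / (s \<bullet> s)"
      using False by (simp add: t_def power2_eq_square)
    finally have "(p \<bullet> s)\<^sup>2 / (s \<bullet> s) \<le> 0" by simp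
    moreover have "s \<bullet> s > 0" using False by simp
    ultimately have "(p \<bullet> s)\<^sup>2 \<le> 0" by (simp add: divide_le_0_iff)
    then show ?thesis by (simp add: inner_commute)
  qed simp
  then show ?thesis using pS by (auto simp: orthogonal_comp_def orthogonal_def)
qed

text \<open>
  Up to a factor the representing vector is the point of a translate of the kernel of \<open>f\<close> that is
  orthogonal to this kernel: it determines \<open>f\<close>, since every \<open>h\<close> differs from a multiple of it by an
  element of the kernel.
\<close>

lemma riesz_representation:
  fixes f :: "'a::{real_inner, complete_space} \<Rightarrow> real"
  assumes "bounded_linear f"
  shows "\<exists>y. \<forall>h. f h = y \<bullet> h"
proof (cases "\<forall>h. f h = 0")
  case True
  then show ?thesis by (intro exI[of _ 0]) simp
next
  case False
  then obtain a where a: "f a \<noteq> 0" by blast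
  interpret f: bounded_linear f by fact
  define S where "S = {x. f x = 0}"
  have "closed S"
    unfolding S_def by (intro closed_Collect_eq continuous_intros f.continuous_on)
  moreover have "subspace S"
    unfolding S_def by (rule subspaceI) (auto simp: f.add f.scaleR)
  ultimately obtain p where "p - a \<in> S" "p \<in> S\<^sup>\<bottom>"
    using translate_meets_orthogonal_comp by blast
  then have fp: "f p \<noteq> 0" and orth: "\<And>s. f s = 0 \<Longrightarrow> p \<bullet> s = 0"
    using a by (auto simp: S_def orthogonal_comp_def orthogonal_def f.diff inner_commute)
  then have pp: "p \<bullet> p \<noteq> 0" by auto
  have "f h = ((f p / (p \<bullet> p)) *\<^sub>R p) \<bullet> h" for h
  proof -
    have "p \<bullet> (h - (f h / f p) *\<^sub>R p) = 0"
      using fp by (intro orth) (simp add: f.diff f.scaleR)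
    then show ?thesis using fp pp by (simp add: inner_simps field_simps)
  qed
  then show ?thesis by blast
qed

section \<open>Normed carriers and multilinear maps\<close>

text \<open>
  The norm of a space of multilinear maps is a supremum, which is a norm only on the bounded maps,
  and the norm of \<open>range_sp R\<close> is one only on the range of \<open>R\<close>; so the norm axioms are
  relativised to the carrier.
\<close>

locale normed_carrier =
  fixes V :: "('a::real_vector, 'm) normed_sp_scheme"
  assumes subspace_carr: "subspace (carr V)"
    and nrm_triangle: "\<lbrakk>x \<in> carr V; y \<in> carr V\<rbrakk> \<Longrightarrow> nrm V (x + y) \<le> nrm V x + nrm V y"
    and nrm_scaleR: "x \<in> carr V \<Longrightarrow> nrm V (c *\<^sub>R x) = \<bar>c\<bar> * nrm V x"
    and nrm_eq_0D: "\<lbrakk>x \<in> carr V; nrm V x = 0\<rbrakk> \<Longrightarrow> x = 0"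
begin

lemma zero_mem [simp]: "0 \<in> carr V"
  and add_mem: "\<lbrakk>x \<in> carr V; y \<in> carr V\<rbrakk> \<Longrightarrow> x + y \<in> carr V"
  and diff_mem: "\<lbrakk>x \<in> carr V; y \<in> carr V\<rbrakk> \<Longrightarrow> x - y \<in> carr V"
  and scaleR_mem: "x \<in> carr V \<Longrightarrow> c *\<^sub>R x \<in> carr V"
  using subspace_carr by (auto intro: subspace_0 subspace_add subspace_diff subspace_scale)

lemma nrm_zero [simp]: "nrm V 0 = 0"
  using nrm_scaleR[of 0 0] by simp

lemma nrm_minus: "x \<in> carr V \<Longrightarrow> nrm V (- x) = nrm V x"
  using nrm_scaleR[of x "-1"] by simp

lemma nrm_nonneg: "x \<in> carr V \<Longrightarrow> 0 \<le> nrm V x"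
  using nrm_triangle[of x "- x"] nrm_minus[of x] scaleR_mem[of x "-1"] by simp

lemma nrm_triangle_diff:
  "\<lbrakk>x \<in> carr V; y \<in> carr V\<rbrakk> \<Longrightarrow> nrm V (x - y) \<le> nrm V x + nrm V y"
  using nrm_triangle[of x "- y"] nrm_minus[of y] scaleR_mem[of y "-1"] by simp

lemma prod_nrm_nonneg: "set hs \<subseteq> carr V \<Longrightarrow> 0 \<le> prod_list (map (nrm V) hs)"
  by (induction hs) (auto simp: nrm_nonneg)

lemma prod_nrm_le_1:
  "\<lbrakk>set hs \<subseteq> carr V; \<forall>h\<in>set hs. nrm V h \<le> 1\<rbrakk> \<Longrightarrow> prod_list (map (nrm V) hs) \<le> 1"
  by (induction hs) (auto simp: nrm_nonneg intro!: mult_le_one prod_nrm_nonneg)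

end

lemma normed_carrier_real_sp: "normed_carrier real_sp"
  by standard (auto simp: real_sp_def abs_mult abs_triangle_ineq)

lemma normed_carrier_whole_sp: "normed_carrier whole_sp"
  by standard (auto simp: whole_sp_def norm_triangle_ineq)

lemma args_Suc: "args (Suc k) V = {hs @ [h] | hs h. hs \<in> args k V \<and> h \<in> carr V}"
proof -
  have "\<exists>gs h. hs = gs @ [h] \<and> length gs = k \<and> set gs \<subseteq> carr V \<and> h \<in> carr V"
    if "length hs = Suc k" "set hs \<subseteq> carr V" for hs
    using that by (cases hs rule: rev_cases) auto
  then show ?thesis by (fastforce simp: args_def)
qed

lemma args_snoc_iff: "hs @ [h] \<in> args (Suc k) V \<longleftrightarrow> hs \<in> args k V \<and> h \<in> carr V"
  by (auto simp: args_def)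

lemma args_0: "args 0 V = {[]}"
  by (auto simp: args_def)

lemma mlin_mapsD:
  assumes "B \<in> mlin_maps k V W"
  shows "\<And>hs. hs \<in> args k V \<Longrightarrow> B hs \<in> carr W"
    and "\<And>hs. hs \<notin> args k V \<Longrightarrow> B hs = 0"
    and "\<And>hs i g h. \<lbrakk>hs \<in> args k V; i < k; g \<in> carr V; h \<in> carr V\<rbrakk> \<Longrightarrow>
      B (hs[i := g + h]) = B (hs[i := g]) + B (hs[i := h])"
    and "\<And>hs i c h. \<lbrakk>hs \<in> args k V; i < k; h \<in> carr V\<rbrakk> \<Longrightarrow>
      B (hs[i := c *\<^sub>R h]) = c *\<^sub>R B (hs[i := h])"
    and "\<exists>C. \<forall>hs\<in>args k V. nrm W (B hs) \<le> C * prod_list (map (nrm V) hs)"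
  using assms by (auto simp: mlin_maps_def)

lemma mlin_mapsI:
  assumes "\<And>hs. hs \<in> args k V \<Longrightarrow> B hs \<in> carr W"
    and "\<And>hs. hs \<notin> args k V \<Longrightarrow> B hs = 0"
    and "\<And>hs i g h. \<lbrakk>hs \<in> args k V; i < k; g \<in> carr V; h \<in> carr V\<rbrakk> \<Longrightarrow>
      B (hs[i := g + h]) = B (hs[i := g]) + B (hs[i := h])"
    and "\<And>hs i c h. \<lbrakk>hs \<in> args k V; i < k; h \<in> carr V\<rbrakk> \<Longrightarrow>
      B (hs[i := c *\<^sub>R h]) = c *\<^sub>R B (hs[i := h])"
    and "\<And>hs. hs \<in> args k V \<Longrightarrow> nrm W (B hs) \<le> C * prod_list (map (nrm V) hs)"
  shows "B \<in> mlin_maps k V W"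
  using assms unfolding mlin_maps_def by blast

lemma mlin_maps_ext:
  assumes "B \<in> mlin_maps k V W" "B' \<in> mlin_maps k V W" "\<And>hs. hs \<in> args k V \<Longrightarrow> B hs = B' hs"
  shows "B = B'"
  using assms mlin_mapsD(2) by (metis ext)

lemma carr_mlin_sp [simp]: "carr (mlin_sp k V W) = mlin_maps k V W"
  and nrm_mlin_sp [simp]: "nrm (mlin_sp k V W) = mlin_norm k V W"
  by (simp_all add: mlin_sp_def)

text \<open>
  Fixing the last argument turns a \<open>k + 1\<close>-linear map into a linear map into the
  \<open>k\<close>-linear maps; this is how derivatives of successive orders are related.
\<close>

definition curry_last :: "('a list \<Rightarrow> 'b) \<Rightarrow> 'a \<Rightarrow> 'a list \<Rightarrow> 'b" where
  "curry_last B h = (\<lambda>hs. B (hs @ [h]))"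

definition uncurry_last :: "('a \<Rightarrow> 'a list \<Rightarrow> 'b::zero) \<Rightarrow> 'a list \<Rightarrow> 'b" where
  "uncurry_last L hs = (if hs = [] then 0 else L (last hs) (butlast hs))"

lemma curry_uncurry_last [simp]: "curry_last (uncurry_last L) = L"
  by (simp add: curry_last_def uncurry_last_def fun_eq_iff)

lemma curry_last_mem_mlin_maps:
  assumes B: "B \<in> mlin_maps (Suc k) V W" and h: "h \<in> carr V"
  shows "curry_last B h \<in> mlin_maps k V W"
proof -
  obtain C where C: "\<forall>hs\<in>args (Suc k) V. nrm W (B hs) \<le> C * prod_list (map (nrm V) hs)"
    using mlin_mapsD(5)[OF B] by blast
  have upd: "(hs @ [h])[i := g] = hs[i := g] @ [h]" if "hs \<in> args k V" "i < k" for hs i g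
    using that by (simp add: args_def list_update_append1)
  show ?thesis
  proof (rule mlin_mapsI)
    fix hs i g g' assume *: "hs \<in> args k V" "i < k" "g \<in> carr V" "g' \<in> carr V"
    then show "curry_last B h (hs[i := g + g']) = curry_last B h (hs[i := g]) + curry_last B h (hs[i := g'])"
      using mlin_mapsD(3)[OF B, of "hs @ [h]" i g g'] h by (simp add: args_snoc_iff upd curry_last_def)
  next
    fix hs i c g assume "hs \<in> args k V" "i < k" "g \<in> carr V"
    then show "curry_last B h (hs[i := c *\<^sub>R g]) = c *\<^sub>R curry_last B h (hs[i := g])"
      using mlin_mapsD(4)[OF B, of "hs @ [h]" i g c] h by (simp add: args_snoc_iff upd curry_last_def)
  next
    fix hs assume "hs \<in> args k V"
    then show "nrm W (curry_last B h hs) \<le> C * nrm V h * prod_list (map (nrm V) hs)"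
      using C[rule_format, of "hs @ [h]"] h by (simp add: args_snoc_iff curry_last_def ac_simps)
  qed (use B h in \<open>auto simp: curry_last_def args_snoc_iff mlin_mapsD\<close>)
qed

locale two_normed_carriers = V: normed_carrier V + W: normed_carrier W
  for V :: "('a::real_vector, 'm) normed_sp_scheme" and W :: "('b::real_vector, 'n) normed_sp_scheme"
begin

lemma mlin_mapsE_bound:
  assumes "B \<in> mlin_maps k V W"
  obtains C where "C \<ge> 0" "\<And>hs. hs \<in> args k V \<Longrightarrow> nrm W (B hs) \<le> C * prod_list (map (nrm V) hs)"
proof -
  obtain C where C: "\<forall>hs\<in>args k V. nrm W (B hs) \<le> C * prod_list (map (nrm V) hs)"
    using mlin_mapsD(5)[OF assms] by blast
  have "nrm W (B hs) \<le> max C 0 * prod_list (map (nrm V) hs)" if "hs \<in> args k V" for hs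
    using C[rule_format, OF that] that
      mult_right_mono[OF max.cobounded1[of C 0] V.prod_nrm_nonneg[of hs]]
    by (auto simp: args_def)
  then show ?thesis by (intro that[of "max C 0"]) auto
qed

lemma replicate_zero_args: "replicate k 0 \<in> args k V"
  by (auto simp: args_def)

lemma mlin_norm_leI:
  assumes "\<And>hs. \<lbrakk>hs \<in> args k V; \<forall>h\<in>set hs. nrm V h \<le> 1\<rbrakk> \<Longrightarrow> nrm W (B hs) \<le> M"
  shows "mlin_norm k V W B \<le> M"
  unfolding mlin_norm_def using replicate_zero_args[of k] assms
  by (intro cSUP_least) (auto intro!: exI[of _ "replicate k 0"])

lemma mlin_norm_le_bound:
  assumes "M \<ge> 0" "\<And>hs. hs \<in> args k V \<Longrightarrow> nrm W (B hs) \<le> M * prod_list (map (nrm V) hs)"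
  shows "mlin_norm k V W B \<le> M"
proof (rule mlin_norm_leI)
  fix hs assume hs: "hs \<in> args k V" "\<forall>h\<in>set hs. nrm V h \<le> 1"
  then have "M * prod_list (map (nrm V) hs) \<le> M * 1"
    using assms(1) by (intro mult_left_mono V.prod_nrm_le_1) (auto simp: args_def)
  then show "nrm W (B hs) \<le> M" using assms(2)[OF hs(1)] by simp
qed

lemma nrm_le_mlin_norm:
  assumes "B \<in> mlin_maps k V W" "hs \<in> args k V" "\<forall>h\<in>set hs. nrm V h \<le> 1"
  shows "nrm W (B hs) \<le> mlin_norm k V W B"
proof -
  obtain C where C: "C \<ge> 0" "\<And>hs. hs \<in> args k V \<Longrightarrow> nrm W (B hs) \<le> C * prod_list (map (nrm V) hs)"
    using mlin_mapsE_bound[OF assms(1)] by blast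
  have "nrm W (B hs) \<le> C" if "hs \<in> args k V" "\<forall>h\<in>set hs. nrm V h \<le> 1" for hs
  proof -
    have "C * prod_list (map (nrm V) hs) \<le> C * 1"
      using that C(1) by (intro mult_left_mono V.prod_nrm_le_1) (auto simp: args_def)
    then show ?thesis using C(2)[OF that(1)] by simp
  qed
  then show ?thesis
    unfolding mlin_norm_def using assms by (intro cSUP_upper) (auto intro!: bdd_aboveI)
qed

lemma mlin_norm_nonneg: "B \<in> mlin_maps k V W \<Longrightarrow> 0 \<le> mlin_norm k V W B"
  using nrm_le_mlin_norm[OF _ replicate_zero_args[of k]]
    W.nrm_nonneg[OF mlin_mapsD(1)[OF _ replicate_zero_args[of k]]] by fastforce

text \<open>Fixing the last argument leaves a multilinear map in the others, to which induction applies.\<close>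

lemma mlin_scale_args:
  assumes "B \<in> mlin_maps k V W" "length hs = k" "\<And>h. h \<in> set hs \<Longrightarrow> g h \<in> carr V"
  shows "B (map (\<lambda>h. c h *\<^sub>R g h) hs) = prod_list (map c hs) *\<^sub>R B (map g hs)"
  using assms
proof (induction k arbitrary: B hs)
  case (Suc k)
  obtain gs h where hs: "hs = gs @ [h]" "length gs = k"
    using Suc.prems(2) by (cases hs rule: rev_cases) auto
  have mem: "g h \<in> carr V" "c h *\<^sub>R g h \<in> carr V" "map g gs @ [g h] \<in> args (Suc k) V"
    using Suc.prems(3) V.scaleR_mem by (auto simp: hs args_def)
  have "B (map (\<lambda>h. c h *\<^sub>R g h) hs) = curry_last B (c h *\<^sub>R g h) (map (\<lambda>h. c h *\<^sub>R g h) gs)"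
    by (simp add: hs curry_last_def)
  also have "\<dots> = prod_list (map c gs) *\<^sub>R curry_last B (c h *\<^sub>R g h) (map g gs)"
    using Suc.prems(3) hs by (intro Suc.IH curry_last_mem_mlin_maps[OF Suc.prems(1) mem(2)]) auto
  also have "curry_last B (c h *\<^sub>R g h) (map g gs) = c h *\<^sub>R B (map g gs @ [g h])"
    using mlin_mapsD(4)[OF Suc.prems(1) mem(3), of k "g h" "c h"] mem hs
    by (simp add: curry_last_def list_update_append)
  finally show ?case by (simp add: hs)
qed simp

text \<open>The supremum over the unit ball bounds the map everywhere: normalise every argument.\<close>

lemma nrm_mlin_le:
  assumes B: "B \<in> mlin_maps k V W" and hs: "hs \<in> args k V"
  shows "nrm W (B hs) \<le> mlin_norm k V W B * prod_list (map (nrm V) hs)"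
proof -
  define u where "u h = inverse (nrm V h) *\<^sub>R h" for h
  have *: "u h \<in> carr V" "nrm V (u h) \<le> 1" "nrm V h *\<^sub>R u h = h" if "h \<in> carr V" for h
    using that V.nrm_nonneg[OF that] V.nrm_eq_0D[OF that] V.nrm_scaleR[OF that, of "inverse (nrm V h)"]
    by (cases "nrm V h = 0"; simp add: u_def V.scaleR_mem)+
  have sub: "set hs \<subseteq> carr V" "length hs = k" using hs by (auto simp: args_def)
  have u_args: "map u hs \<in> args k V" "\<forall>h\<in>set (map u hs). nrm V h \<le> 1"
    using sub * by (auto simp: args_def)
  have "map (\<lambda>h. nrm V h *\<^sub>R u h) hs = hs"
    using sub *(3) by (intro map_idI) auto
  then have "B hs = prod_list (map (nrm V) hs) *\<^sub>R B (map u hs)"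
    using mlin_scale_args[OF B sub(2), of u "nrm V"] sub *(1) by auto
  then have "nrm W (B hs) = prod_list (map (nrm V) hs) * nrm W (B (map u hs))"
    using W.nrm_scaleR[OF mlin_mapsD(1)[OF B u_args(1)]] V.prod_nrm_nonneg[OF sub(1)] by simp
  also have "\<dots> \<le> prod_list (map (nrm V) hs) * mlin_norm k V W B"
    by (intro mult_left_mono nrm_le_mlin_norm B u_args V.prod_nrm_nonneg sub)
  finally show ?thesis by (simp add: mult.commute)
qed

lemma subspace_mlin_maps: "subspace (mlin_maps k V W)"
proof (rule subspaceI)
  show "0 \<in> mlin_maps k V W"
    by (rule mlin_mapsI[where C = 0]) auto
next
  fix B B' assume B: "B \<in> mlin_maps k V W" "B' \<in> mlin_maps k V W"
  show "B + B' \<in> mlin_maps k V W"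
  proof (rule mlin_mapsI)
    fix hs assume hs: "hs \<in> args k V"
    have "nrm W (B hs + B' hs) \<le> nrm W (B hs) + nrm W (B' hs)"
      by (intro W.nrm_triangle mlin_mapsD(1)[OF _ hs] B)
    also have "\<dots> \<le> (mlin_norm k V W B + mlin_norm k V W B') * prod_list (map (nrm V) hs)"
      using nrm_mlin_le[OF B(1) hs] nrm_mlin_le[OF B(2) hs] by (simp add: distrib_right)
    finally show "nrm W ((B + B') hs) \<le> \<dots>" by simp
  qed (simp_all add: W.add_mem mlin_mapsD[OF B(1)] mlin_mapsD[OF B(2)] scaleR_add_right)
next
  fix c B assume B: "B \<in> mlin_maps k V W"
  show "c *\<^sub>R B \<in> mlin_maps k V W"
  proof (rule mlin_mapsI)
    fix hs assume hs: "hs \<in> args k V"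
    show "nrm W ((c *\<^sub>R B) hs) \<le> (\<bar>c\<bar> * mlin_norm k V W B) * prod_list (map (nrm V) hs)"
      using W.nrm_scaleR[OF mlin_mapsD(1)[OF B hs]] nrm_mlin_le[OF B hs]
      by (simp add: scaleR_fun_def mult_left_mono mult.assoc)
  qed (simp_all add: scaleR_fun_def W.scaleR_mem mlin_mapsD[OF B] scaleR_add_right)
qed

lemma mlin_norm_eq_0D:
  assumes "B \<in> mlin_maps k V W" "mlin_norm k V W B = 0"
  shows "B = 0"
proof
  fix hs show "B hs = 0 hs"
  proof (cases "hs \<in> args k V")
    case True
    then have "nrm W (B hs) = 0"
      using nrm_mlin_le[OF assms(1) True] W.nrm_nonneg[OF mlin_mapsD(1)[OF assms(1) True]] assms(2)
      by simp
    then show ?thesis using W.nrm_eq_0D mlin_mapsD(1)[OF assms(1) True] by simp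
  qed (simp add: mlin_mapsD[OF assms(1)])
qed

lemma mlin_norm_scaleR_le:
  assumes "B \<in> mlin_maps k V W"
  shows "mlin_norm k V W (c *\<^sub>R B) \<le> \<bar>c\<bar> * mlin_norm k V W B"
proof (rule mlin_norm_leI)
  fix hs assume "hs \<in> args k V" "\<forall>h\<in>set hs. nrm V h \<le> 1"
  then show "nrm W ((c *\<^sub>R B) hs) \<le> \<bar>c\<bar> * mlin_norm k V W B"
    using nrm_le_mlin_norm[OF assms] W.nrm_scaleR[OF mlin_mapsD(1)[OF assms]]
    by (simp add: scaleR_fun_def mult_left_mono)
qed

lemma normed_carrier_mlin_sp: "normed_carrier (mlin_sp k V W)"
proof
  show "subspace (carr (mlin_sp k V W))"
    using subspace_mlin_maps by simp
next
  fix B B' assume "B \<in> carr (mlin_sp k V W)" "B' \<in> carr (mlin_sp k V W)"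
  then have B: "B \<in> mlin_maps k V W" "B' \<in> mlin_maps k V W" by simp_all
  show "nrm (mlin_sp k V W) (B + B') \<le> nrm (mlin_sp k V W) B + nrm (mlin_sp k V W) B'"
    unfolding nrm_mlin_sp
  proof (rule mlin_norm_leI)
    fix hs assume hs: "hs \<in> args k V" "\<forall>h\<in>set hs. nrm V h \<le> 1"
    have "nrm W (B hs + B' hs) \<le> nrm W (B hs) + nrm W (B' hs)"
      by (intro W.nrm_triangle mlin_mapsD(1)[OF _ hs(1)] B)
    then show "nrm W ((B + B') hs) \<le> mlin_norm k V W B + mlin_norm k V W B'"
      using nrm_le_mlin_norm[OF B(1) hs] nrm_le_mlin_norm[OF B(2) hs] by simp
  qed
next
  fix c B assume "B \<in> carr (mlin_sp k V W)"
  then have B: "B \<in> mlin_maps k V W" by simp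
  have "mlin_norm k V W (c *\<^sub>R B) = \<bar>c\<bar> * mlin_norm k V W B"
  proof (cases "c = 0")
    case True
    then show ?thesis
      using mlin_norm_scaleR_le[OF B, of 0] mlin_norm_nonneg[OF subspace_scale[OF subspace_mlin_maps B, of 0]]
      by simp
  next
    case False
    have "mlin_norm k V W (inverse c *\<^sub>R (c *\<^sub>R B)) \<le> \<bar>inverse c\<bar> * mlin_norm k V W (c *\<^sub>R B)"
      by (intro mlin_norm_scaleR_le subspace_scale[OF subspace_mlin_maps B])
    then have "\<bar>c\<bar> * mlin_norm k V W B \<le> mlin_norm k V W (c *\<^sub>R B)"
      using False by (simp add: abs_inverse field_simps)
    then show ?thesis using mlin_norm_scaleR_le[OF B, of c] by simp
  qed
  then show "nrm (mlin_sp k V W) (c *\<^sub>R B) = \<bar>c\<bar> * nrm (mlin_sp k V W) B" by simp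
next
  fix B assume "B \<in> carr (mlin_sp k V W)" "nrm (mlin_sp k V W) B = 0"
  then show "B = 0" using mlin_norm_eq_0D by simp
qed

sublocale mlin: normed_carrier "mlin_sp k V W" for k
  by (rule normed_carrier_mlin_sp)

lemma curry_last_mem_lin_maps:
  assumes B: "B \<in> mlin_maps (Suc k) V W"
  shows "curry_last B \<in> lin_maps V (mlin_sp k V W)"
proof -
  have upd: "(hs @ [0])[k := g] = hs @ [g]" if "hs \<in> args k V" for hs g
    using that by (auto simp: args_def)
  have "curry_last B (g + h) = curry_last B g + curry_last B h" if "g \<in> carr V" "h \<in> carr V" for g h
  proof (rule mlin_maps_ext)
    show "curry_last B (g + h) \<in> mlin_maps k V W" "curry_last B g + curry_last B h \<in> mlin_maps k V W"
      using that by (auto intro!: curry_last_mem_mlin_maps[OF B] V.add_mem subspace_add[OF subspace_mlin_maps])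
    fix hs assume "hs \<in> args k V"
    then show "curry_last B (g + h) hs = (curry_last B g + curry_last B h) hs"
      using mlin_mapsD(3)[OF B, of "hs @ [0]" k g h] that
      by (simp add: curry_last_def upd args_snoc_iff)
  qed
  moreover have "curry_last B (c *\<^sub>R h) = c *\<^sub>R curry_last B h" if "h \<in> carr V" for c h
  proof (rule mlin_maps_ext)
    show "curry_last B (c *\<^sub>R h) \<in> mlin_maps k V W" "c *\<^sub>R curry_last B h \<in> mlin_maps k V W"
      using that by (auto intro!: curry_last_mem_mlin_maps[OF B] V.scaleR_mem subspace_scale[OF subspace_mlin_maps])
    fix hs assume "hs \<in> args k V"
    then show "curry_last B (c *\<^sub>R h) hs = (c *\<^sub>R curry_last B h) hs"
      using mlin_mapsD(4)[OF B, of "hs @ [0]" k h c] that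
      by (simp add: curry_last_def upd args_snoc_iff scaleR_fun_def)
  qed
  moreover have "mlin_norm k V W (curry_last B h) \<le> mlin_norm (Suc k) V W B * nrm V h"
    if "h \<in> carr V" for h
  proof (rule mlin_norm_le_bound)
    show "0 \<le> mlin_norm (Suc k) V W B * nrm V h"
      using that by (simp add: mlin_norm_nonneg[OF B] V.nrm_nonneg)
    fix hs assume "hs \<in> args k V"
    then show "nrm W (curry_last B h hs) \<le> mlin_norm (Suc k) V W B * nrm V h * prod_list (map (nrm V) hs)"
      using nrm_mlin_le[OF B, of "hs @ [h]"] that by (simp add: curry_last_def args_snoc_iff ac_simps)
  qed
  moreover have "curry_last B h = 0" if "h \<notin> carr V" for h
    using that by (auto simp: curry_last_def fun_eq_iff args_snoc_iff mlin_mapsD(2)[OF B])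
  ultimately show ?thesis
    unfolding lin_maps_def using curry_last_mem_mlin_maps[OF B]
    by (auto intro!: exI[of _ "mlin_norm (Suc k) V W B"])
qed

lemma uncurry_last_mem_mlin_maps:
  assumes L: "L \<in> lin_maps V (mlin_sp k V W)"
  shows "uncurry_last L \<in> mlin_maps (Suc k) V W"
proof -
  have Lh: "L h \<in> mlin_maps k V W" if "h \<in> carr V" for h
    using L that by (auto simp: lin_maps_def)
  obtain C where C: "\<forall>h\<in>carr V. mlin_norm k V W (L h) \<le> C * nrm V h"
    using L by (auto simp: lin_maps_def)
  have ev: "uncurry_last L (hs @ [h]) = L h hs" for hs h
    by (simp add: uncurry_last_def)
  have upd: "(hs @ [h])[i := g] = (if i < k then hs[i := g] @ [h] else hs @ [g])"
    if "hs \<in> args k V" "i < Suc k" for hs h i g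
    using that by (auto simp: args_def list_update_append less_Suc_eq)
  show ?thesis
  proof (rule mlin_mapsI)
    fix hs assume "hs \<in> args (Suc k) V"
    then show "uncurry_last L hs \<in> carr W"
      by (auto simp: args_Suc ev mlin_mapsD(1)[OF Lh])
  next
    fix hs assume *: "hs \<notin> args (Suc k) V"
    show "uncurry_last L hs = 0"
    proof (cases hs rule: rev_cases)
      case (snoc gs h)
      then show ?thesis using * L
        by (cases "h \<in> carr V") (auto simp: ev args_snoc_iff mlin_mapsD(2)[OF Lh] lin_maps_def)
    qed (simp add: uncurry_last_def)
  next
    fix hs i g g' assume "hs \<in> args (Suc k) V" "i < Suc k" "g \<in> carr V" "g' \<in> carr V"
    then show "uncurry_last L (hs[i := g + g']) = uncurry_last L (hs[i := g]) + uncurry_last L (hs[i := g'])"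
      using L by (auto simp: args_Suc upd ev mlin_mapsD(3)[OF Lh] lin_maps_def)
  next
    fix hs i c g assume "hs \<in> args (Suc k) V" "i < Suc k" "g \<in> carr V"
    then show "uncurry_last L (hs[i := c *\<^sub>R g]) = c *\<^sub>R uncurry_last L (hs[i := g])"
      using L by (auto simp: args_Suc upd ev mlin_mapsD(4)[OF Lh] lin_maps_def scaleR_fun_def)
  next
    fix hs assume "hs \<in> args (Suc k) V"
    then obtain gs h where hs: "hs = gs @ [h]" "gs \<in> args k V" "h \<in> carr V"
      by (auto simp: args_Suc)
    have "nrm W (L h gs) \<le> mlin_norm k V W (L h) * prod_list (map (nrm V) gs)"
      by (rule nrm_mlin_le[OF Lh[OF hs(3)] hs(2)])
    also have "\<dots> \<le> (C * nrm V h) * prod_list (map (nrm V) gs)"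
      using hs C by (intro mult_right_mono V.prod_nrm_nonneg) (auto simp: args_def)
    finally show "nrm W (uncurry_last L hs) \<le> C * prod_list (map (nrm V) hs)"
      by (simp add: hs ev ac_simps)
  qed
qed

end

text \<open>
  Changing the arguments of a multilinear map by \<open>A\<close> and its values by \<open>T\<close> is bounded and linear
  in the map. Every passage from \<open>H\<close> to the directions in the range of \<open>R\<close> is of this form.
\<close>

definition pull ::
  "nat \<Rightarrow> ('c, 'm) normed_sp_scheme \<Rightarrow> ('c \<Rightarrow> 'a) \<Rightarrow> ('b \<Rightarrow> 'd::zero) \<Rightarrow> ('a list \<Rightarrow> 'b) \<Rightarrow> 'c list \<Rightarrow> 'd"
where
  "pull k V' A T B = (\<lambda>hs. if hs \<in> args k V' then T (B (map A hs)) else 0)"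

locale pullback =
  src: two_normed_carriers V W + tgt: two_normed_carriers V' W'
  for V :: "('a::real_vector, 'm) normed_sp_scheme" and W :: "('b::real_vector, 'n) normed_sp_scheme"
    and V' :: "('c::real_vector, 'm') normed_sp_scheme" and W' :: "('d::real_vector, 'n') normed_sp_scheme" +
  fixes A :: "'c \<Rightarrow> 'a" and T :: "'b \<Rightarrow> 'd" and a c :: real
  assumes linear_A: "linear A" and A_mem: "h \<in> carr V' \<Longrightarrow> A h \<in> carr V"
    and A_bound: "h \<in> carr V' \<Longrightarrow> nrm V (A h) \<le> a * nrm V' h" and a_nonneg: "a \<ge> 0"
    and linear_T: "linear T" and T_mem: "w \<in> carr W \<Longrightarrow> T w \<in> carr W'"
    and T_bound: "w \<in> carr W \<Longrightarrow> nrm W' (T w) \<le> c * nrm W w" and c_nonneg: "c \<ge> 0"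
begin

lemma map_A_args: "hs \<in> args k V' \<Longrightarrow> map A hs \<in> args k V"
  using A_mem by (auto simp: args_def)

lemma prod_nrm_map_A:
  "hs \<in> args k V' \<Longrightarrow> prod_list (map (nrm V) (map A hs)) \<le> a ^ k * prod_list (map (nrm V') hs)"
proof (induction k arbitrary: hs)
  case (Suc k)
  then obtain gs h where hs: "hs = gs @ [h]" "gs \<in> args k V'" "h \<in> carr V'"
    by (auto simp: args_Suc)
  have "prod_list (map (nrm V) (map A gs)) * nrm V (A h)
      \<le> (a ^ k * prod_list (map (nrm V') gs)) * (a * nrm V' h)"
    using hs map_A_args[OF hs(2)] A_mem
    by (intro mult_mono Suc.IH A_bound mult_nonneg_nonneg zero_le_power a_nonneg
        tgt.V.prod_nrm_nonneg src.V.nrm_nonneg) (auto simp: args_def)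
  then show ?case by (simp add: hs ac_simps)
qed (simp add: args_0)

lemma pull_bound:
  assumes B: "B \<in> mlin_maps k V W" and hs: "hs \<in> args k V'"
  shows "nrm W' (pull k V' A T B hs) \<le> (c * a ^ k * mlin_norm k V W B) * prod_list (map (nrm V') hs)"
proof -
  have "nrm W' (T (B (map A hs))) \<le> c * nrm W (B (map A hs))"
    by (intro T_bound mlin_mapsD(1)[OF B] map_A_args hs)
  also have "\<dots> \<le> c * (mlin_norm k V W B * prod_list (map (nrm V) (map A hs)))"
    by (intro mult_left_mono c_nonneg src.nrm_mlin_le[OF B] map_A_args hs)
  also have "\<dots> \<le> c * (mlin_norm k V W B * (a ^ k * prod_list (map (nrm V') hs)))"
    by (intro mult_left_mono c_nonneg src.mlin_norm_nonneg[OF B] prod_nrm_map_A hs)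
  finally show ?thesis using hs by (simp add: pull_def ac_simps)
qed

lemma pull_mem:
  assumes B: "B \<in> mlin_maps k V W"
  shows "pull k V' A T B \<in> mlin_maps k V' W'"
proof (rule mlin_mapsI)
  have upd: "hs[i := g] \<in> args k V'" if "hs \<in> args k V'" "i < k" "g \<in> carr V'" for hs i g
    using that set_update_subset_insert[of hs i g] by (auto simp: args_def)
  fix hs i g g' assume *: "hs \<in> args k V'" "i < k" "g \<in> carr V'" "g' \<in> carr V'"
  show "pull k V' A T B (hs[i := g + g']) = pull k V' A T B (hs[i := g]) + pull k V' A T B (hs[i := g'])"
    using * mlin_mapsD(3)[OF B map_A_args[OF *(1)] *(2) A_mem A_mem, of g g']
    by (simp add: pull_def upd tgt.V.add_mem map_update linear_add[OF linear_A] linear_add[OF linear_T])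
  fix r
  show "pull k V' A T B (hs[i := r *\<^sub>R g]) = r *\<^sub>R pull k V' A T B (hs[i := g])"
    using * mlin_mapsD(4)[OF B map_A_args[OF *(1)] *(2) A_mem, of g r]
    by (simp add: pull_def upd tgt.V.scaleR_mem map_update linear_scale[OF linear_A] linear_scale[OF linear_T])
next
  fix hs assume "hs \<in> args k V'"
  then show "nrm W' (pull k V' A T B hs) \<le> (c * a ^ k * mlin_norm k V W B) * prod_list (map (nrm V') hs)"
    by (rule pull_bound[OF B])
qed (auto simp: pull_def intro!: T_mem mlin_mapsD(1)[OF B] map_A_args)

lemma mlin_norm_pull:
  assumes "B \<in> mlin_maps k V W"
  shows "mlin_norm k V' W' (pull k V' A T B) \<le> c * a ^ k * mlin_norm k V W B"
  using assms a_nonneg c_nonneg src.mlin_norm_nonneg[OF assms]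
  by (intro tgt.mlin_norm_le_bound pull_bound) auto

lemma pull_diff: "pull k V' A T (B - B') = pull k V' A T B - pull k V' A T B'"
  by (simp add: pull_def fun_eq_iff linear_diff[OF linear_T])

lemma curry_last_pull:
  "h \<in> carr V' \<Longrightarrow> curry_last (pull (Suc k) V' A T B) h = pull k V' A T (curry_last B (A h))"
  by (simp add: pull_def curry_last_def fun_eq_iff args_snoc_iff)

lemma BUC_pull:
  assumes "F \<in> BUC (mlin_sp k V W)"
  shows "(\<lambda>x. pull k V' A T (F x)) \<in> BUC (mlin_sp k V' W')"
proof -
  have F: "F x \<in> mlin_maps k V W" for x using assms by (auto simp: BUC_def)
  obtain M where M: "\<And>x. mlin_norm k V W (F x) \<le> M"
    using assms by (auto simp: BUC_def)
  define K where "K = c * a ^ k"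
  have K: "K \<ge> 0" by (simp add: K_def a_nonneg c_nonneg)
  have "mlin_norm k V' W' (pull k V' A T (F x)) \<le> K * M" for x
    using mlin_norm_pull[OF F, of x] mult_left_mono[OF M[of x] K] by (simp add: K_def)
  moreover have "\<exists>d>0. \<forall>x y. dist x y < d \<longrightarrow>
      mlin_norm k V' W' (pull k V' A T (F x) - pull k V' A T (F y)) < e" if "e > 0" for e
  proof -
    have "e / (K + 1) > 0" using that K by simp
    then obtain d where d: "d > 0" "\<And>x y. dist x y < d \<Longrightarrow> mlin_norm k V W (F x - F y) < e / (K + 1)"
      using assms by (auto simp: BUC_def)
    have "mlin_norm k V' W' (pull k V' A T (F x) - pull k V' A T (F y)) < e" if "dist x y < d" for x y
    proof -
      have mem: "F x - F y \<in> mlin_maps k V W"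
        by (intro subspace_diff src.subspace_mlin_maps F)
      have "mlin_norm k V' W' (pull k V' A T (F x - F y)) \<le> K * mlin_norm k V W (F x - F y)"
        using mlin_norm_pull[OF mem] by (simp add: K_def)
      also have "\<dots> \<le> (K + 1) * mlin_norm k V W (F x - F y)"
        using src.mlin_norm_nonneg[OF mem] by (simp add: mult_right_mono)
      also have "\<dots> < e" using d(2)[OF that] K by (simp add: field_simps)
      finally show ?thesis by (simp add: pull_diff)
    qed
    then show ?thesis using d(1) by blast
  qed
  ultimately show ?thesis by (auto simp: BUC_def intro!: pull_mem F)
qed

end

section \<open>Derivatives along a normed carrier\<close>

lemma eventually_nonzero_to_zero:
  fixes n :: "'a \<Rightarrow> real"
  shows "eventually P (inf (filtercomap n (at 0)) (principal S)) \<longleftrightarrow>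
    (\<exists>d>0. \<forall>h\<in>S. n h \<noteq> 0 \<and> \<bar>n h\<bar> < d \<longrightarrow> P h)"
proof
  assume "eventually P (inf (filtercomap n (at 0)) (principal S))"
  then obtain Q where Q: "eventually Q (at 0)" "\<And>h. Q (n h) \<Longrightarrow> h \<in> S \<Longrightarrow> P h"
    unfolding eventually_inf_principal eventually_filtercomap by blast
  then show "\<exists>d>0. \<forall>h\<in>S. n h \<noteq> 0 \<and> \<bar>n h\<bar> < d \<longrightarrow> P h"
    unfolding eventually_at by (auto simp: dist_real_def)
next
  assume "\<exists>d>0. \<forall>h\<in>S. n h \<noteq> 0 \<and> \<bar>n h\<bar> < d \<longrightarrow> P h"
  then obtain d where d: "d > 0" "\<And>h. \<lbrakk>h \<in> S; n h \<noteq> 0; \<bar>n h\<bar> < d\<rbrakk> \<Longrightarrow> P h" by blast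
  have "eventually (\<lambda>r. r \<noteq> 0 \<and> \<bar>r\<bar> < d) (at (0::real))"
    using d(1) by (auto simp: eventually_at dist_real_def)
  then show "eventually P (inf (filtercomap n (at 0)) (principal S))"
    unfolding eventually_inf_principal eventually_filtercomap using d(2) by blast
qed

text \<open>
  Bounding the remainder by \<open>e * nrm V h\<close> avoids the quotient, so that \<open>h = 0\<close> needs no exception.
\<close>

lemma (in two_normed_carriers) has_fderiv_along_iff:
  assumes F: "\<And>x. F x \<in> carr W"
  shows "has_fderiv_along V W F x L \<longleftrightarrow> L \<in> lin_maps V W \<and>
    (\<forall>e>0. \<exists>d>0. \<forall>h\<in>carr V. nrm V h < d \<longrightarrow> nrm W (F (x + h) - F x - L h) \<le> e * nrm V h)"
    (is "_ \<longleftrightarrow> _ \<and> ?bound")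
proof (cases "L \<in> lin_maps V W")
  case L: True
  define q where "q h = nrm W (F (x + h) - F x - L h)" for h
  have q: "q h \<ge> 0" if "h \<in> carr V" for h
    unfolding q_def using L that by (intro W.nrm_nonneg W.diff_mem F) (auto simp: lin_maps_def)
  have L0: "L 0 = 0"
    using L V.zero_mem by (auto simp: lin_maps_def dest!: spec[of _ 0])
  have "has_fderiv_along V W F x L \<longleftrightarrow>
      (\<forall>e>0. \<exists>d>0. \<forall>h\<in>carr V. nrm V h \<noteq> 0 \<and> \<bar>nrm V h\<bar> < d \<longrightarrow> \<bar>q h / nrm V h\<bar> < e)"
    using L unfolding has_fderiv_along_def q_def[symmetric] tendsto_iff dist_real_def
      eventually_nonzero_to_zero
    by simp
  also have "\<dots> \<longleftrightarrow> (\<forall>e>0. \<exists>d>0. \<forall>h\<in>carr V. nrm V h < d \<longrightarrow> q h \<le> e * nrm V h)"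
    (is "?l \<longleftrightarrow> ?r")
  proof
    assume l: ?l
    show ?r
    proof (intro allI impI)
      fix e :: real assume "e > 0"
      then obtain d where d: "d > 0" "\<forall>h\<in>carr V. nrm V h \<noteq> 0 \<and> \<bar>nrm V h\<bar> < d \<longrightarrow> \<bar>q h / nrm V h\<bar> < e"
        using l by blast
      have "q h \<le> e * nrm V h" if "h \<in> carr V" "nrm V h < d" for h
      proof (cases "nrm V h = 0")
        case True
        then have "h = 0" using that V.nrm_eq_0D by blast
        then show ?thesis by (simp add: q_def L0)
      next
        case False
        then show ?thesis
          using d(2)[rule_format, OF that(1)] that V.nrm_nonneg[OF that(1)] q[OF that(1)]
          by (simp add: field_simps)
      qed
      then show "\<exists>d>0. \<forall>h\<in>carr V. nrm V h < d \<longrightarrow> q h \<le> e * nrm V h" using d(1) by blast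
    qed
  next
    assume r: ?r
    show ?l
    proof (intro allI impI)
      fix e :: real assume "e > 0"
      then have "e / 2 > 0" by simp
      then obtain d where d: "d > 0" "\<forall>h\<in>carr V. nrm V h < d \<longrightarrow> q h \<le> e / 2 * nrm V h"
        using r by blast
      have "\<bar>q h / nrm V h\<bar> < e" if "h \<in> carr V" "nrm V h \<noteq> 0" "\<bar>nrm V h\<bar> < d" for h
      proof -
        have pos: "nrm V h > 0" using that V.nrm_nonneg[OF that(1)] by simp
        have "q h \<le> e / 2 * nrm V h" using d(2) that by auto
        also have "\<dots> < e * nrm V h" using \<open>e > 0\<close> pos by simp
        finally show ?thesis using pos q[OF that(1)] by (simp add: field_simps)
      qed
      then show "\<exists>d>0. \<forall>h\<in>carr V. nrm V h \<noteq> 0 \<and> \<bar>nrm V h\<bar> < d \<longrightarrow> \<bar>q h / nrm V h\<bar> < e"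
        using d(1) by blast
    qed
  qed
  finally show ?thesis using L by (simp add: q_def)
qed (simp add: has_fderiv_along_def)

text \<open>
  Two derivatives differ on \<open>t *\<^sub>R h\<close> by at most \<open>e * t * nrm V h\<close> once \<open>t\<close> is small; by linearity
  the factor \<open>t\<close> cancels.
\<close>

lemma (in two_normed_carriers) has_fderiv_along_unique:
  assumes F: "\<And>x. F x \<in> carr W"
    and L: "has_fderiv_along V W F x L" "has_fderiv_along V W F x L'"
  shows "L = L'"
proof
  have lin: "L \<in> lin_maps V W" "L' \<in> lin_maps V W"
    using L by (auto simp: has_fderiv_along_def)
  fix h show "L h = L' h"
  proof (cases "h \<in> carr V")
    case h: True
    have mem: "L g \<in> carr W" "L' g \<in> carr W" if "g \<in> carr V" for g
      using lin that by (auto simp: lin_maps_def)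
    have small: "nrm W (L h - L' h) \<le> e * nrm V h" if "e > 0" for e
    proof -
      have "e / 2 > 0" using that by simp
      from L(1)[unfolded has_fderiv_along_iff[OF F], THEN conjunct2, rule_format, OF this]
      obtain d where d: "d > 0" "\<forall>h\<in>carr V. nrm V h < d \<longrightarrow> nrm W (F (x + h) - F x - L h) \<le> e/2 * nrm V h"
        by blast
      from L(2)[unfolded has_fderiv_along_iff[OF F], THEN conjunct2, rule_format, OF \<open>e / 2 > 0\<close>]
      obtain d' where d': "d' > 0" "\<forall>h\<in>carr V. nrm V h < d' \<longrightarrow> nrm W (F (x + h) - F x - L' h) \<le> e/2 * nrm V h"
        by blast
      \<comment> \<open>a factor that carries \<open>h\<close> into both neighbourhoods; the \<open>1\<close> keeps the denominator positive\<close>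
      define t where "t = min d d' / (2 * (nrm V h + 1))"
      have nn: "nrm V h \<ge> 0" using h by (rule V.nrm_nonneg)
      have t: "t > 0" using d(1) d'(1) nn by (simp add: t_def)
      have "t * nrm V h < t * (2 * (nrm V h + 1))"
        using t nn by (intro mult_strict_left_mono) auto
      also have "\<dots> = min d d'" using nn by (simp add: t_def)
      finally have th: "nrm V (t *\<^sub>R h) < d" "nrm V (t *\<^sub>R h) < d'"
        using t h by (auto simp: V.nrm_scaleR)
      have tc: "t *\<^sub>R h \<in> carr V" using h by (rule V.scaleR_mem)
      have "t *\<^sub>R (L h - L' h) = (F (x + t *\<^sub>R h) - F x - L' (t *\<^sub>R h)) - (F (x + t *\<^sub>R h) - F x - L (t *\<^sub>R h))"
        using lin h by (simp add: lin_maps_def scaleR_diff_right)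
      also have "nrm W \<dots> \<le> nrm W (F (x + t *\<^sub>R h) - F x - L' (t *\<^sub>R h)) + nrm W (F (x + t *\<^sub>R h) - F x - L (t *\<^sub>R h))"
        by (intro W.nrm_triangle_diff W.diff_mem F mem tc)
      also have "\<dots> \<le> e/2 * nrm V (t *\<^sub>R h) + e/2 * nrm V (t *\<^sub>R h)"
        using d d' th tc by (intro add_mono) auto
      finally have "t * nrm W (L h - L' h) \<le> t * (e * nrm V h)"
        using t h by (simp add: W.nrm_scaleR V.nrm_scaleR W.diff_mem mem)
      then show ?thesis using t by simp
    qed
    have "nrm W (L h - L' h) \<le> 0"
    proof (rule field_le_epsilon)
      fix e :: real assume "e > 0"
      have "e / (nrm V h + 1) > 0" using \<open>e > 0\<close> V.nrm_nonneg[OF h] by simp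
      from small[OF this] have "nrm W (L h - L' h) \<le> e / (nrm V h + 1) * nrm V h" .
      also have "\<dots> \<le> e"
        using \<open>e > 0\<close> V.nrm_nonneg[OF h] by (simp add: field_simps)
      finally show "nrm W (L h - L' h) \<le> 0 + e" by simp
    qed
    then have "L h - L' h = 0"
      using W.nrm_nonneg[of "L h - L' h"] W.diff_mem mem h by (intro W.nrm_eq_0D) auto
    then show ?thesis by simp
  qed (use lin in \<open>simp add: lin_maps_def\<close>)
qed

lemma (in two_normed_carriers) fderiv_along_eqI:
  assumes "\<And>x. F x \<in> carr W" "has_fderiv_along V W F x L"
  shows "fderiv_along V W F x = L"
  unfolding fderiv_along_def using assms has_fderiv_along_unique by blast

lemma fderiv_pow_Suc_uncurry:
  "fderiv_pow V (Suc k) f x = uncurry_last (fderiv_along V (mlin_sp k V real_sp) (fderiv_pow V k f) x)"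
  by (simp add: uncurry_last_def fun_eq_iff)

lemma const_map_mem_mlin_maps: "b \<in> carr W \<Longrightarrow> const_map b \<in> mlin_maps 0 V W"
  by (rule mlin_mapsI[where C = "nrm W b"]) (auto simp: args_0 const_map_def)

context normed_carrier
begin

lemma two_normed_real: "two_normed_carriers V real_sp"
  by (intro two_normed_carriers.intro normed_carrier_axioms normed_carrier_real_sp)

lemma two_normed_forms: "two_normed_carriers V (mlin_sp k V real_sp)"
  by (intro two_normed_carriers.intro normed_carrier_axioms
      two_normed_carriers.normed_carrier_mlin_sp two_normed_real)

lemma fderiv_pow_mem:
  "fdifferentiable_times V k f \<Longrightarrow> fderiv_pow V k f x \<in> mlin_maps k V real_sp"
proof (induction k arbitrary: x)
  case 0
  then show ?case by (auto intro!: const_map_mem_mlin_maps simp: real_sp_def)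
next
  case (Suc k)
  interpret two_normed_carriers V "mlin_sp k V real_sp" by (rule two_normed_forms)
  obtain L where L: "has_fderiv_along V (mlin_sp k V real_sp) (fderiv_pow V k f) x L"
    using Suc.prems by auto
  have "fderiv_along V (mlin_sp k V real_sp) (fderiv_pow V k f) x = L"
    using Suc L by (intro fderiv_along_eqI) auto
  then show ?case
    using L unfolding fderiv_pow_Suc_uncurry has_fderiv_along_def
    by (auto intro: two_normed_carriers.uncurry_last_mem_mlin_maps[OF two_normed_real])
qed

lemma has_fderiv_along_fderiv_pow:
  assumes "fdifferentiable_times V (Suc k) f"
  shows "has_fderiv_along V (mlin_sp k V real_sp) (fderiv_pow V k f) x
    (curry_last (fderiv_pow V (Suc k) f x))"
proof -
  interpret two_normed_carriers V "mlin_sp k V real_sp" by (rule two_normed_forms)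
  obtain L where L: "has_fderiv_along V (mlin_sp k V real_sp) (fderiv_pow V k f) x L"
    using assms by auto
  have "fderiv_along V (mlin_sp k V real_sp) (fderiv_pow V k f) x = L"
    using assms L by (intro fderiv_along_eqI) (auto simp: fderiv_pow_mem)
  then show ?thesis using L unfolding fderiv_pow_Suc_uncurry by simp
qed

lemma fdifferentiable_times_mono:
  "\<lbrakk>fdifferentiable_times V k f; i \<le> k\<rbrakk> \<Longrightarrow> fdifferentiable_times V i f"
  by (induction k) (auto simp: le_Suc_eq)

text \<open>
  The iterated derivatives are nested definite descriptions. This lemma identifies them with any
  family of forms in which each member differentiates to the next.
\<close>

lemma fderiv_pow_eqI:
  assumes "\<And>x. E 0 x = const_map (f x)"
    and mem: "\<And>i x. i \<le> k \<Longrightarrow> E i x \<in> mlin_maps i V real_sp"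
    and deriv: "\<And>i x. i < k \<Longrightarrow>
      has_fderiv_along V (mlin_sp i V real_sp) (E i) x (curry_last (E (Suc i) x))"
  shows "fdifferentiable_times V k f \<and> fderiv_pow V k f = E k"
  using mem deriv
proof (induction k)
  case 0
  then show ?case using assms(1) by (simp add: fun_eq_iff)
next
  case (Suc k)
  then have IH: "fdifferentiable_times V k f" "fderiv_pow V k f = E k" by auto
  interpret two_normed_carriers V "mlin_sp k V real_sp" by (rule two_normed_forms)
  have "fderiv_along V (mlin_sp k V real_sp) (E k) x = curry_last (E (Suc k) x)" for x
    using Suc.prems by (intro fderiv_along_eqI) auto
  moreover have "uncurry_last (curry_last (E (Suc k) x)) = E (Suc k) x" for x
  proof
    fix hs show "uncurry_last (curry_last (E (Suc k) x)) hs = E (Suc k) x hs"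
      using mlin_mapsD(2)[OF Suc.prems(1)[of "Suc k" x], of "[]"]
      by (cases hs rule: rev_cases) (auto simp: uncurry_last_def curry_last_def args_def)
  qed
  ultimately have "fderiv_pow V (Suc k) f = E (Suc k)"
    by (intro ext[where 'a = 'a]) (simp only: fderiv_pow_Suc_uncurry IH)
  then show ?case using IH Suc.prems(2) by auto
qed

end

section \<open>Symmetry of second derivatives\<close>

text \<open>
  The second difference over a parallelogram of side \<open>s\<close> equals \<open>s\<^sup>2\<close> times the mixed derivative at
  a point near \<open>x\<close>, by two applications of the mean value theorem.
\<close>

lemma second_difference_mean_value:
  fixes f :: "'a::real_normed_vector \<Rightarrow> real"
  assumes "\<And>x. ((\<lambda>t. f (x + t *\<^sub>R g)) has_real_derivative fg x) (at 0)"
    and "\<And>x. ((\<lambda>t. fg (x + t *\<^sub>R h)) has_real_derivative fgh x) (at 0)"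
    and s: "s > 0"
  shows "\<exists>p\<in>cball x (s * (norm g + norm h)).
    f (x + s *\<^sub>R g + s *\<^sub>R h) - f (x + s *\<^sub>R g) - f (x + s *\<^sub>R h) + f x = s\<^sup>2 * fgh p"
proof -
  have shift: "((\<lambda>t. u (y + t *\<^sub>R e)) has_real_derivative u' (y + t *\<^sub>R e)) (at t)"
    if "\<And>x. ((\<lambda>t. u (x + t *\<^sub>R e)) has_real_derivative u' x) (at 0)" for u u' :: "'a \<Rightarrow> real" and y e t
  proof -
    have "(\<lambda>r. u (y + (r + t) *\<^sub>R e)) = (\<lambda>r. u ((y + t *\<^sub>R e) + r *\<^sub>R e))"
      by (simp add: scaleR_add_left add_ac)
    then show ?thesis
      using that[of "y + t *\<^sub>R e"] DERIV_shift[of "\<lambda>t. u (y + t *\<^sub>R e)" "u' (y + t *\<^sub>R e)" 0 t]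
      by simp
  qed
  note shift_f = shift[where u = f and u' = fg and e = g, OF assms(1)]
    and shift_fg = shift[where u = fg and u' = fgh and e = h, OF assms(2)]
  have "((\<lambda>t. f ((x + s *\<^sub>R h) + t *\<^sub>R g) - f (x + t *\<^sub>R g)) has_real_derivative
      fg ((x + s *\<^sub>R h) + t *\<^sub>R g) - fg (x + t *\<^sub>R g)) (at t)" for t
    by (intro DERIV_diff shift_f)
  from MVT2[OF s this] obtain \<xi> where \<xi>: "0 < \<xi>" "\<xi> < s"
    "(f ((x + s *\<^sub>R h) + s *\<^sub>R g) - f (x + s *\<^sub>R g)) - (f (x + s *\<^sub>R h) - f x)
      = s * (fg ((x + s *\<^sub>R h) + \<xi> *\<^sub>R g) - fg (x + \<xi> *\<^sub>R g))"
    by auto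
  have "((\<lambda>t. fg ((x + \<xi> *\<^sub>R g) + t *\<^sub>R h)) has_real_derivative fgh ((x + \<xi> *\<^sub>R g) + t *\<^sub>R h)) (at t)" for t
    by (rule shift_fg)
  from MVT2[OF s this] obtain \<eta> where \<eta>: "0 < \<eta>" "\<eta> < s"
    "fg ((x + \<xi> *\<^sub>R g) + s *\<^sub>R h) - fg (x + \<xi> *\<^sub>R g) = s * fgh ((x + \<xi> *\<^sub>R g) + \<eta> *\<^sub>R h)"
    by auto
  have "norm (\<xi> *\<^sub>R g + \<eta> *\<^sub>R h) \<le> \<xi> * norm g + \<eta> * norm h"
    using \<xi> \<eta> norm_triangle_ineq[of "\<xi> *\<^sub>R g" "\<eta> *\<^sub>R h"] by simp
  also have "\<dots> \<le> s * (norm g + norm h)"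
    using \<xi> \<eta> by (simp add: distrib_left add_mono mult_right_mono)
  finally have "(x + \<xi> *\<^sub>R g) + \<eta> *\<^sub>R h \<in> cball x (s * (norm g + norm h))"
    by (simp add: dist_norm norm_minus_commute algebra_simps)
  moreover have "fg ((x + s *\<^sub>R h) + \<xi> *\<^sub>R g) - fg (x + \<xi> *\<^sub>R g) = s * fgh ((x + \<xi> *\<^sub>R g) + \<eta> *\<^sub>R h)"
    using \<eta>(3) by (simp add: algebra_simps)
  then have "f (x + s *\<^sub>R g + s *\<^sub>R h) - f (x + s *\<^sub>R g) - f (x + s *\<^sub>R h) + f x
      = s\<^sup>2 * fgh ((x + \<xi> *\<^sub>R g) + \<eta> *\<^sub>R h)"
    using \<xi>(3) by (simp add: power2_eq_square algebra_simps)
  ultimately show ?thesis by blast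
qed

text \<open>
  The second difference is symmetric in \<open>g\<close> and \<open>h\<close>, so for every \<open>s\<close> one mixed derivative at
  some point equals the other at some other point, both at a distance of order \<open>s\<close> from \<open>x\<close>.
\<close>

lemma mixed_derivatives_commute:
  fixes f :: "'a::real_normed_vector \<Rightarrow> real"
  assumes "\<And>x. ((\<lambda>t. f (x + t *\<^sub>R g)) has_real_derivative fg x) (at 0)"
    and "\<And>x. ((\<lambda>t. f (x + t *\<^sub>R h)) has_real_derivative fh x) (at 0)"
    and "\<And>x. ((\<lambda>t. fg (x + t *\<^sub>R h)) has_real_derivative fgh x) (at 0)"
    and "\<And>x. ((\<lambda>t. fh (x + t *\<^sub>R g)) has_real_derivative fhg x) (at 0)"
    and "isCont fgh x" "isCont fhg x"
  shows "fgh x = fhg x"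
proof (rule ccontr)
  assume neq: "fgh x \<noteq> fhg x"
  define e where "e = \<bar>fgh x - fhg x\<bar> / 2"
  have e: "e > 0" using neq by (simp add: e_def)
  obtain d where d: "d > 0" "\<And>p. dist p x < d \<Longrightarrow> dist (fgh p) (fgh x) < e"
    using assms(5) e unfolding continuous_at_eps_delta by blast
  obtain d' where d': "d' > 0" "\<And>p. dist p x < d' \<Longrightarrow> dist (fhg p) (fhg x) < e"
    using assms(6) e unfolding continuous_at_eps_delta by blast
  define s where "s = min d d' / (norm g + norm h + 1)"
  have s: "s > 0" using d(1) d'(1) by (simp add: s_def add_nonneg_pos)
  have "s * (norm g + norm h) < s * (norm g + norm h + 1)" using s by simp
  also have "\<dots> = min d d'"
    using add_nonneg_pos[of "norm g + norm h" 1] by (simp add: s_def)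
  finally have near: "s * (norm g + norm h) < min d d'" .
  obtain p where p: "p \<in> cball x (s * (norm g + norm h))"
    "f (x + s *\<^sub>R g + s *\<^sub>R h) - f (x + s *\<^sub>R g) - f (x + s *\<^sub>R h) + f x = s\<^sup>2 * fgh p"
    using second_difference_mean_value[OF assms(1,3) s] by blast
  obtain q where q: "q \<in> cball x (s * (norm h + norm g))"
    "f (x + s *\<^sub>R h + s *\<^sub>R g) - f (x + s *\<^sub>R h) - f (x + s *\<^sub>R g) + f x = s\<^sup>2 * fhg q"
    using second_difference_mean_value[OF assms(2,4) s] by blast
  have "s\<^sup>2 * fgh p = s\<^sup>2 * fhg q" using p(2) q(2) by (simp add: algebra_simps)
  then have "fgh p = fhg q" using s by simp
  moreover have "dist (fgh p) (fgh x) < e" "dist (fhg q) (fhg x) < e"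
    using p(1) q(1) near by (auto intro!: d(2) d'(2) simp: dist_commute add.commute)
  ultimately show False by (simp add: e_def dist_real_def abs_if split: if_splits)
qed

section \<open>Derivatives and gradients along the whole space\<close>

lemma carr_whole_sp [simp]: "carr whole_sp = UNIV"
  and nrm_whole_sp [simp]: "nrm whole_sp = norm"
  and ip_whole_sp [simp]: "ip whole_sp = inner"
  by (simp_all add: whole_sp_def)

lemma carr_real_sp [simp]: "carr real_sp = UNIV"
  and nrm_real_sp [simp]: "nrm real_sp = abs"
  by (simp_all add: real_sp_def fun_eq_iff)

interpretation whole: normed_carrier whole_sp
  by (rule normed_carrier_whole_sp)

interpretation whole_maps: two_normed_carriers whole_sp whole_sp
  by (intro two_normed_carriers.intro normed_carrier_whole_sp)

interpretation whole_forms: two_normed_carriers whole_sp real_sp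
  by (rule whole.two_normed_real)

lemma args_whole_sp [simp]: "hs \<in> args k whole_sp \<longleftrightarrow> length hs = k"
  by (simp add: args_def)

lemma vector_eq_inner: "(\<And>w. x \<bullet> w = y \<bullet> w) \<Longrightarrow> x = y"
  for x y :: "'a::real_inner"
  by (metis vector_eq_rdot)

text \<open>
  Testing against \<open>w = m\<close> shows that a vector-valued multilinear map is no larger than the
  form that it represents.
\<close>

lemma norm_le_of_inner:
  assumes N: "N \<in> mlin_maps (Suc k) whole_sp real_sp" and hs: "length hs = k"
    and MN: "\<And>w. m \<bullet> w = N (hs @ [w])"
  shows "norm m \<le> mlin_norm (Suc k) whole_sp real_sp N * prod_list (map norm hs)" (is "_ \<le> ?c")
proof -
  have "norm m * norm m = N (hs @ [m])"
    using MN[of m] by (simp add: power2_norm_eq_inner flip: power2_eq_square)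
  also have "\<dots> \<le> ?c * norm m"
    using whole_forms.nrm_mlin_le[OF N, of "hs @ [m]"] hs by (simp add: mult.assoc)
  finally have "norm m * norm m \<le> ?c * norm m" .
  moreover have "0 \<le> ?c"
    using whole.prod_nrm_nonneg[of hs] whole_forms.mlin_norm_nonneg[OF N] by simp
  ultimately show ?thesis by (cases "m = 0") auto
qed

lemma mlin_norm_le_of_inner:
  assumes "N \<in> mlin_maps (Suc k) whole_sp real_sp"
    and "\<And>hs w. length hs = k \<Longrightarrow> M hs \<bullet> w = N (hs @ [w])"
  shows "mlin_norm k whole_sp whole_sp M \<le> mlin_norm (Suc k) whole_sp real_sp N"
  using assms whole_forms.mlin_norm_nonneg[OF assms(1)]
  by (intro whole_maps.mlin_norm_le_bound) (simp_all add: norm_le_of_inner)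

text \<open>
  The vector that represents a functional is unique, and so inherits additivity and homogeneity in
  the remaining arguments.
\<close>

lemma riesz_multilinear:
  fixes N :: "'a::{real_inner, complete_space} list \<Rightarrow> real"
  assumes N: "N \<in> mlin_maps (Suc k) whole_sp real_sp"
  shows "\<exists>M\<in>mlin_maps k whole_sp whole_sp. \<forall>hs h. length hs = k \<longrightarrow> N (hs @ [h]) = M hs \<bullet> h"
proof -
  have upd: "(hs @ [h])[i := g] = hs[i := g] @ [h]" if "i < length hs" for hs :: "'a list" and h i g
    using that by (simp add: list_update_append1)
  have "\<exists>y. \<forall>h. N (hs @ [h]) = y \<bullet> h" if "length hs = k" for hs
  proof (rule riesz_representation)
    have add: "N (hs @ [g + h]) = N (hs @ [g]) + N (hs @ [h])"
      and scale: "N (hs @ [c *\<^sub>R h]) = c *\<^sub>R N (hs @ [h])" for g h c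
      using mlin_mapsD(3)[OF N, of "hs @ [0]" k g h] mlin_mapsD(4)[OF N, of "hs @ [0]" k h c] that
      by (auto simp: list_update_append)
    show "bounded_linear (\<lambda>h. N (hs @ [h]))"
    proof (rule bounded_linear_intro)
      show "norm (N (hs @ [h])) \<le> norm h * (mlin_norm (Suc k) whole_sp real_sp N * prod_list (map norm hs))" for h
        using whole_forms.nrm_mlin_le[OF N, of "hs @ [h]"] that by (simp add: ac_simps)
    qed (simp_all add: add scale)
  qed
  then obtain M0 where M0: "\<And>hs h. length hs = k \<Longrightarrow> N (hs @ [h]) = M0 hs \<bullet> h"
    by metis
  define M where "M hs = (if length hs = k then M0 hs else 0)" for hs
  have M: "M hs \<bullet> h = N (hs @ [h])" if "length hs = k" for hs h
    using M0 that by (simp add: M_def)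
  have "M \<in> mlin_maps k whole_sp whole_sp"
  proof (rule mlin_mapsI)
    fix hs :: "'a list" and i g g' assume *: "hs \<in> args k whole_sp" "i < k"
    show "M (hs[i := g + g']) = M (hs[i := g]) + M (hs[i := g'])"
    proof (rule vector_eq_inner)
      show "M (hs[i := g + g']) \<bullet> w = (M (hs[i := g]) + M (hs[i := g'])) \<bullet> w" for w
        using mlin_mapsD(3)[OF N, of "hs @ [w]" i g g'] * by (simp add: M inner_add_left upd)
    qed
    fix c
    show "M (hs[i := c *\<^sub>R g]) = c *\<^sub>R M (hs[i := g])"
    proof (rule vector_eq_inner)
      show "M (hs[i := c *\<^sub>R g]) \<bullet> w = (c *\<^sub>R M (hs[i := g])) \<bullet> w" for w
        using mlin_mapsD(4)[OF N, of "hs @ [w]" i g c] * by (simp add: M upd)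
    qed
  next
    fix hs :: "'a list" assume hs: "hs \<in> args k whole_sp"
    then show "nrm whole_sp (M hs) \<le> mlin_norm (Suc k) whole_sp real_sp N * prod_list (map (nrm whole_sp) hs)"
      using norm_le_of_inner[OF N, of hs "M hs"] M by simp
  qed (auto simp: M_def)
  moreover have "\<forall>hs h. length hs = k \<longrightarrow> N (hs @ [h]) = M hs \<bullet> h"
    by (simp add: M)
  ultimately show ?thesis by blast
qed

lemma nabla_eqI:
  assumes nondeg: "\<And>g g'. \<lbrakk>g \<in> carr V; g' \<in> carr V; \<And>h. h \<in> carr V \<Longrightarrow> ip V g h = ip V g' h\<rbrakk> \<Longrightarrow> g = g'"
    and G: "G \<in> mlin_maps k V V"
    and eq: "\<And>hs h. \<lbrakk>hs \<in> args k V; h \<in> carr V\<rbrakk> \<Longrightarrow> fderiv_pow V (Suc k) f x (hs @ [h]) = ip V (G hs) h"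
  shows "nabla V (Suc k) f x = G"
  unfolding nabla_def
proof (rule the_equality)
  show "G \<in> mlin_maps (Suc k - 1) V V \<and> (\<forall>hs\<in>args (Suc k - 1) V. \<forall>h\<in>carr V.
      fderiv_pow V (Suc k) f x (hs @ [h]) = ip V (G hs) h)"
    using G eq by simp
  fix G' assume G': "G' \<in> mlin_maps (Suc k - 1) V V \<and> (\<forall>hs\<in>args (Suc k - 1) V. \<forall>h\<in>carr V.
      fderiv_pow V (Suc k) f x (hs @ [h]) = ip V (G' hs) h)"
  show "G' = G"
  proof (rule mlin_maps_ext)
    show "G' \<in> mlin_maps k V V" "G \<in> mlin_maps k V V" using G G' by simp_all
    fix hs assume hs: "hs \<in> args k V"
    then show "G' hs = G hs"
      using G' eq mlin_mapsD(1)[OF G hs] mlin_mapsD(1)[of G' k V V hs]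
      by (intro nondeg) (auto simp del: fderiv_pow.simps)
  qed
qed

text \<open>
  By Riesz representation the description defining the gradient of order \<open>k + 1\<close> is satisfied
  along the whole space.
\<close>

lemma nabla_whole:
  fixes f :: "'a::{real_inner, complete_space} \<Rightarrow> real"
  assumes "fdifferentiable_times whole_sp (Suc k) f"
  shows "nabla whole_sp (Suc k) f x \<in> mlin_maps k whole_sp whole_sp"
    and "length hs = k \<Longrightarrow> fderiv_pow whole_sp (Suc k) f x (hs @ [h]) = nabla whole_sp (Suc k) f x hs \<bullet> h"
proof -
  obtain M where M: "M \<in> mlin_maps k whole_sp whole_sp"
    "\<And>hs h. length hs = k \<Longrightarrow> fderiv_pow whole_sp (Suc k) f x (hs @ [h]) = M hs \<bullet> h"
    using riesz_multilinear[OF whole.fderiv_pow_mem[OF assms]] by blast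
  have "nabla whole_sp (Suc k) f x = M"
    using M by (intro nabla_eqI) (auto simp del: fderiv_pow.simps intro: vector_eq_inner)
  then show "nabla whole_sp (Suc k) f x \<in> mlin_maps k whole_sp whole_sp"
    and "length hs = k \<Longrightarrow> fderiv_pow whole_sp (Suc k) f x (hs @ [h]) = nabla whole_sp (Suc k) f x hs \<bullet> h"
    using M by simp_all
qed

text \<open>
  The remainder of the Frechet derivative at \<open>s *\<^sub>R u\<close>, divided by \<open>s\<close>. The convergence is uniform
  in the \<open>k\<close> arguments of the form, as the \<open>R\<close>-derivative requires.
\<close>

lemma fderiv_pow_difference_quotient:
  fixes f :: "'a::{real_inner, complete_space} \<Rightarrow> real"
  assumes diff: "fdifferentiable_times whole_sp (Suc k) f"
  shows "((\<lambda>s. mlin_norm k whole_sp real_sp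
      ((1 / s) *\<^sub>R (fderiv_pow whole_sp k f (x + s *\<^sub>R u) - fderiv_pow whole_sp k f x)
        - curry_last (fderiv_pow whole_sp (Suc k) f x) u)) \<longlongrightarrow> 0) (at 0)"
proof -
  let ?D = "fderiv_pow whole_sp k f" and ?L = "curry_last (fderiv_pow whole_sp (Suc k) f x)"
  interpret two_normed_carriers "whole_sp :: 'a hilbert_sp" "mlin_sp k (whole_sp :: 'a hilbert_sp) real_sp"
    by (rule whole.two_normed_forms)
  have mem: "?D y \<in> mlin_maps k whole_sp real_sp" for y
    using diff by (intro whole.fderiv_pow_mem) simp
  have L: "?L \<in> lin_maps whole_sp (mlin_sp k whole_sp real_sp)"
    and deriv: "\<And>e. e > 0 \<Longrightarrow> \<exists>d>0. \<forall>h. norm h < d \<longrightarrow>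
      mlin_norm k whole_sp real_sp (?D (x + h) - ?D x - ?L h) \<le> e * norm h"
    using whole.has_fderiv_along_fderiv_pow[OF diff, of x] has_fderiv_along_iff[of ?D x ?L] mem
    by (auto simp del: fderiv_pow.simps)
  have Lmem: "?L h \<in> mlin_maps k whole_sp real_sp" for h
    using L by (auto simp: lin_maps_def)
  define q where "q s = (1 / s) *\<^sub>R (?D (x + s *\<^sub>R u) - ?D x) - ?L u" for s
  have qmem: "q s \<in> mlin_maps k whole_sp real_sp" for s
    unfolding q_def
    by (intro subspace_diff[OF whole_forms.subspace_mlin_maps]
        subspace_scale[OF whole_forms.subspace_mlin_maps] mem Lmem)
  have "\<exists>d>0. \<forall>s. s \<noteq> 0 \<and> \<bar>s\<bar> < d \<longrightarrow> mlin_norm k whole_sp real_sp (q s) < e" if "e > 0" for e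
  proof -
    define e' where "e' = e / (norm u + 1)"
    have "e' > 0" using that by (simp add: e'_def add_nonneg_pos)
    then obtain d where d: "d > 0" "\<And>h. norm h < d \<Longrightarrow>
        mlin_norm k whole_sp real_sp (?D (x + h) - ?D x - ?L h) \<le> e' * norm h"
      using deriv by blast
    have "mlin_norm k whole_sp real_sp (q s) < e" if s: "s \<noteq> 0" "\<bar>s\<bar> < d / (norm u + 1)" for s
    proof -
      have pos: "norm u + 1 > 0" by (simp add: add_nonneg_pos)
      have "\<bar>s\<bar> * norm u \<le> \<bar>s\<bar> * (norm u + 1)" by (simp add: mult_left_mono)
      also have "\<dots> < d" using s pos by (simp add: field_simps)
      finally have small: "norm (s *\<^sub>R u) < d" by simp
      have "s *\<^sub>R q s = ?D (x + s *\<^sub>R u) - ?D x - ?L (s *\<^sub>R u)"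
        using L s by (simp add: q_def scaleR_diff_right lin_maps_def)
      then have "\<bar>s\<bar> * mlin_norm k whole_sp real_sp (q s) \<le> e' * norm (s *\<^sub>R u)"
        using d(2)[OF small] whole_forms.mlin.nrm_scaleR[of "q s" k s] qmem by simp
      then have "\<bar>s\<bar> * mlin_norm k whole_sp real_sp (q s) \<le> \<bar>s\<bar> * (e' * norm u)"
        by (simp add: ac_simps)
      then have "mlin_norm k whole_sp real_sp (q s) \<le> e' * norm u" using s by simp
      also have "\<dots> < e' * (norm u + 1)" using \<open>e' > 0\<close> by simp
      also have "\<dots> = e" using pos by (simp add: e'_def)
      finally show ?thesis .
    qed
    moreover have "d / (norm u + 1) > 0" using d(1) by (simp add: add_nonneg_pos)
    ultimately show ?thesis by blast
  qed
  then have "((\<lambda>s. mlin_norm k whole_sp real_sp (q s)) \<longlongrightarrow> 0) (at 0)"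
    using whole_forms.mlin_norm_nonneg[OF qmem] by (auto simp: tendsto_iff eventually_at dist_real_def)
  then show ?thesis by (simp add: q_def)
qed

lemma fderiv_pow_has_real_derivative:
  fixes f :: "'a::{real_inner, complete_space} \<Rightarrow> real"
  assumes diff: "fdifferentiable_times whole_sp (Suc k) f" and hs: "length hs = k"
  shows "((\<lambda>s. fderiv_pow whole_sp k f (x + s *\<^sub>R u) hs) has_real_derivative
      fderiv_pow whole_sp (Suc k) f x (hs @ [u])) (at 0)"
proof -
  let ?D = "fderiv_pow whole_sp k f" and ?L = "curry_last (fderiv_pow whole_sp (Suc k) f x)"
  define q where "q s = (1 / s) *\<^sub>R (?D (x + s *\<^sub>R u) - ?D x) - ?L u" for s
  have qmem: "q s \<in> mlin_maps k whole_sp real_sp" for s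
    unfolding q_def using diff
    by (intro subspace_diff[OF whole_forms.subspace_mlin_maps] subspace_scale[OF whole_forms.subspace_mlin_maps]
        curry_last_mem_mlin_maps whole.fderiv_pow_mem) auto
  have "((\<lambda>s. mlin_norm k whole_sp real_sp (q s) * prod_list (map norm hs)) \<longlongrightarrow> 0) (at 0)"
    unfolding q_def by (rule tendsto_mult_left_zero[OF fderiv_pow_difference_quotient[OF diff]])
  then have "((\<lambda>s. q s hs) \<longlongrightarrow> 0) (at 0)"
    by (rule Lim_null_comparison[rotated])
      (use whole_forms.nrm_mlin_le[OF qmem, of hs] hs in \<open>auto intro!: always_eventually\<close>)
  then have "((\<lambda>s. (?D (x + s *\<^sub>R u) hs - ?D x hs) / s - ?L u hs) \<longlongrightarrow> 0) (at 0)"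
    by (simp add: q_def scaleR_fun_def divide_inverse mult.commute)
  then have "((\<lambda>s. (?D (x + s *\<^sub>R u) hs - ?D x hs) / s) \<longlongrightarrow> ?L u hs) (at 0)"
    by (simp add: Lim_null[symmetric])
  then show ?thesis by (simp add: has_field_derivative_iff curry_last_def)
qed

text \<open>
  Continuity of the derivative of order \<open>k + 2\<close> makes the last two directions of differentiation
  interchangeable.
\<close>

lemma fderiv_pow_swap_last:
  fixes f :: "'a::{real_inner, complete_space} \<Rightarrow> real"
  assumes f: "f \<in> BUC_diff whole_sp (Suc (Suc k))" and hs: "length hs = k"
  shows "fderiv_pow whole_sp (Suc (Suc k)) f x (hs @ [g, h]) = fderiv_pow whole_sp (Suc (Suc k)) f x (hs @ [h, g])"
proof -
  have diff: "fdifferentiable_times whole_sp (Suc (Suc k)) f"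
    using f by (simp add: BUC_diff_def del: fdifferentiable_times.simps)
  have diff': "fdifferentiable_times whole_sp (Suc k) f" using diff by simp
  let ?G = "nabla whole_sp (Suc (Suc k)) f"
  have G: "?G \<in> BUC (mlin_sp (Suc k) whole_sp whole_sp)"
    using f by (auto simp: BUC_diff_def dest!: bspec[of _ _ "Suc (Suc k)"])
  have cont: "isCont (\<lambda>x. fderiv_pow whole_sp (Suc (Suc k)) f x (gs @ [w])) x"
    if gs: "length gs = Suc k" for gs w x
  proof -
    have "isCont (\<lambda>x. ?G x gs) x"
      unfolding continuous_at_eps_delta
    proof (intro allI impI)
      fix e :: real assume "e > 0"
      define c where "c = prod_list (map norm gs)"
      have c: "c \<ge> 0" using whole.prod_nrm_nonneg[of gs] by (simp add: c_def)
      then have "e / (c + 1) > 0" using \<open>e > 0\<close> by simp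
      then obtain d where d: "d > 0" "\<And>x y. dist x y < d \<Longrightarrow>
          mlin_norm (Suc k) whole_sp whole_sp (?G x - ?G y) < e / (c + 1)"
        using G by (auto simp: BUC_def)
      have "dist (?G y gs) (?G x gs) < e" if "dist y x < d" for y
      proof -
        have "norm (?G y gs - ?G x gs) \<le> mlin_norm (Suc k) whole_sp whole_sp (?G y - ?G x) * c"
          using whole_maps.nrm_mlin_le[OF subspace_diff[OF whole_maps.subspace_mlin_maps
                nabla_whole(1)[OF diff] nabla_whole(1)[OF diff]], of gs y x] gs
          by (simp add: c_def)
        also have "\<dots> \<le> e / (c + 1) * c"
          using d(2)[OF that] c by (intro mult_right_mono) auto
        also have "\<dots> < e" using c \<open>e > 0\<close> by (simp add: field_simps)
        finally show ?thesis by (simp add: dist_norm)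
      qed
      then show "\<exists>d>0. \<forall>y. dist y x < d \<longrightarrow> dist (?G y gs) (?G x gs) < e" using d(1) by blast
    qed
    then show ?thesis using gs by (simp only: nabla_whole(2)[OF diff]) (intro continuous_intros)
  qed
  let ?D1 = "fderiv_pow whole_sp (Suc k) f" and ?D2 = "fderiv_pow whole_sp (Suc (Suc k)) f"
  have "?D2 x ((hs @ [g]) @ [h]) = ?D2 x ((hs @ [h]) @ [g])"
  proof (rule mixed_derivatives_commute[where f = "\<lambda>x. fderiv_pow whole_sp k f x hs"
        and fg = "\<lambda>x. ?D1 x (hs @ [g])" and fh = "\<lambda>x. ?D1 x (hs @ [h])"
        and fgh = "\<lambda>x. ?D2 x ((hs @ [g]) @ [h])" and fhg = "\<lambda>x. ?D2 x ((hs @ [h]) @ [g])"])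
    show "((\<lambda>t. fderiv_pow whole_sp k f (y + t *\<^sub>R u) hs) has_real_derivative ?D1 y (hs @ [u])) (at 0)" for y u
      by (rule fderiv_pow_has_real_derivative[OF diff' hs])
    then show "((\<lambda>t. fderiv_pow whole_sp k f (y + t *\<^sub>R h) hs) has_real_derivative ?D1 y (hs @ [h])) (at 0)" for y .
    show "((\<lambda>t. ?D1 (y + t *\<^sub>R h) (hs @ [g])) has_real_derivative ?D2 y ((hs @ [g]) @ [h])) (at 0)"
      and "((\<lambda>t. ?D1 (y + t *\<^sub>R g) (hs @ [h])) has_real_derivative ?D2 y ((hs @ [h]) @ [g])) (at 0)" for y
      by (rule fderiv_pow_has_real_derivative[OF diff], simp add: hs)+
    show "isCont (\<lambda>x. ?D2 x ((hs @ [g]) @ [h])) x" "isCont (\<lambda>x. ?D2 x ((hs @ [h]) @ [g])) x"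
      by (rule cont, simp add: hs)+
  qed
  then show ?thesis by (simp del: fderiv_pow.simps)
qed

section \<open>Directions in the range of a self-adjoint operator\<close>

locale selfadjoint =
  fixes R :: "'a::{real_inner, complete_space} \<Rightarrow> 'a"
  assumes bounded_linear_R: "bounded_linear R"
    and symmetric_R: "R x \<bullet> y = x \<bullet> R y"
begin

sublocale R: bounded_linear R by (rule bounded_linear_R)

abbreviation ker :: "'a set" where "ker \<equiv> {x. R x = 0}"

lemma range_orthogonal_ker: "R y \<in> ker\<^sup>\<bottom>"
  by (simp add: orthogonal_comp_def orthogonal_def symmetric_R[symmetric])

lemma inj_on_ker_orthogonal: "inj_on R (ker\<^sup>\<bottom>)"
proof (rule inj_onI)
  fix u v assume uv: "u \<in> ker\<^sup>\<bottom>" "v \<in> ker\<^sup>\<bottom>" "R u = R v"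
  then have "u - v \<in> ker\<^sup>\<bottom>" "u - v \<in> ker"
    by (auto simp: R.diff intro: subspace_diff[OF subspace_orthogonal_comp])
  then have "(u - v) \<bullet> (u - v) = 0"
    unfolding orthogonal_comp_def orthogonal_def by blast
  then show "u = v" by simp
qed

lemma image_ker_orthogonal: "R ` (ker\<^sup>\<bottom>) = range R"
proof -
  have ker: "closed ker" "subspace ker"
    by (auto intro!: closed_Collect_eq R.continuous_on continuous_intros subspaceI simp: R.add R.scaleR)
  have "\<exists>u\<in>ker\<^sup>\<bottom>. R y = R u" for y
  proof -
    obtain p where "p - y \<in> ker" "p \<in> ker\<^sup>\<bottom>"
      using translate_meets_orthogonal_comp[OF ker, of y] by blast
    moreover from this(1) have "R y = R p" by (simp add: R.diff)
    ultimately show ?thesis by blast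
  qed
  then show ?thesis by (auto simp: image_iff)
qed

lemma R_inv_mem: "x \<in> range R \<Longrightarrow> R_inv R x \<in> ker\<^sup>\<bottom>"
  and R_R_inv: "x \<in> range R \<Longrightarrow> R (R_inv R x) = x"
  unfolding R_inv_def image_ker_orthogonal[symmetric]
  by (rule inv_into_into, assumption) (rule f_inv_into_f)

lemma R_inv_R: "u \<in> ker\<^sup>\<bottom> \<Longrightarrow> R_inv R (R u) = u"
  unfolding R_inv_def by (rule inv_into_f_f[OF inj_on_ker_orthogonal])

lemma R_inv_add: "\<lbrakk>x \<in> range R; y \<in> range R\<rbrakk> \<Longrightarrow> R_inv R (x + y) = R_inv R x + R_inv R y"
  using R_inv_R[of "R_inv R x + R_inv R y"]
  by (simp add: R.add R_R_inv R_inv_mem subspace_add[OF subspace_orthogonal_comp])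

lemma R_inv_scaleR: "x \<in> range R \<Longrightarrow> R_inv R (c *\<^sub>R x) = c *\<^sub>R R_inv R x"
  using R_inv_R[of "c *\<^sub>R R_inv R x"]
  by (simp add: R.scaleR R_R_inv R_inv_mem subspace_scale[OF subspace_orthogonal_comp])

lemma carr_range_sp [simp]: "carr (range_sp R) = range R"
  and nrm_range_sp [simp]: "nrm (range_sp R) x = norm (R_inv R x)"
  and ip_range_sp [simp]: "ip (range_sp R) x y = R_inv R x \<bullet> R_inv R y"
  by (simp_all add: range_sp_def norm_eq_sqrt_inner)

lemma normed_carrier_range_sp: "normed_carrier (range_sp R)"
proof
  show "subspace (carr (range_sp R))"
    using linear_subspace_image[OF R.linear_axioms subspace_UNIV] by simp
  show "x = 0" if "x \<in> carr (range_sp R)" "nrm (range_sp R) x = 0" for x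
    using that R_R_inv[of x] by (simp add: R.zero)
qed (simp_all add: R_inv_add R_inv_scaleR norm_triangle_ineq)

sublocale range: normed_carrier "range_sp R"
  by (rule normed_carrier_range_sp)

sublocale range_forms: two_normed_carriers "range_sp R" real_sp
  by (rule range.two_normed_real)

text \<open>Positive, so that it may be divided by even when \<open>R = 0\<close>.\<close>

definition K :: real where "K = (SOME K. K > 0 \<and> (\<forall>x. norm (R x) \<le> norm x * K))"

lemma K_pos: "K > 0" and norm_R_le: "norm (R x) \<le> K * norm x"
  using someI_ex[OF R.pos_bounded] unfolding K_def[symmetric] by (auto simp: mult.commute)

lemma norm_le_nrm_range: "h \<in> range R \<Longrightarrow> norm h \<le> K * nrm (range_sp R) h"
  using norm_R_le[of "R_inv R h"] by (simp add: R_R_inv)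

text \<open>
  The first two turn derivatives and gradients along \<open>H\<close> into those along \<open>range_sp R\<close>. The last
  two insert \<open>R v\<close> for every argument \<open>v\<close>; a gradient gets a further \<open>R\<close> outside because its value
  stands for the last argument of a form.
\<close>

sublocale restrict: pullback whole_sp real_sp "range_sp R" real_sp "\<lambda>h. h" "\<lambda>r. r" K 1
  using K_pos norm_le_nrm_range
  by unfold_locales (auto simp: linear_iff)

sublocale restrict_grad: pullback whole_sp whole_sp "range_sp R" "range_sp R" "\<lambda>h. h" "\<lambda>v. R (R v)" K K
  using K_pos norm_le_nrm_range norm_R_le
  by unfold_locales (auto simp: linear_iff R.add R.scaleR R_inv_R range_orthogonal_ker)

sublocale subst_form: pullback whole_sp real_sp whole_sp real_sp R "\<lambda>r. r" K 1
  using K_pos norm_R_le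
  by unfold_locales (auto simp: linear_iff R.add R.scaleR)

sublocale subst_grad: pullback whole_sp whole_sp whole_sp whole_sp R R K K
  using K_pos norm_R_le
  by unfold_locales (auto simp: linear_iff R.add R.scaleR)

text \<open>
  Since the inclusion of \<open>range_sp R\<close> in \<open>H\<close> is bounded, a derivative along \<open>H\<close> restricts to one
  along \<open>range_sp R\<close>.
\<close>

lemma has_fderiv_along_restrict:
  assumes F: "\<And>x. F x \<in> mlin_maps i whole_sp real_sp" and B: "B \<in> mlin_maps (Suc i) whole_sp real_sp"
    and deriv: "has_fderiv_along whole_sp (mlin_sp i whole_sp real_sp) F x (curry_last B)"
  shows "has_fderiv_along (range_sp R) (mlin_sp i (range_sp R) real_sp)
    (\<lambda>x. pull i (range_sp R) (\<lambda>h. h) (\<lambda>r. r) (F x)) x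
    (curry_last (pull (Suc i) (range_sp R) (\<lambda>h. h) (\<lambda>r. r) B))"
proof -
  let ?p = "\<lambda>i. pull i (range_sp R) (\<lambda>h. h) (\<lambda>r. r)"
  have expand: "\<exists>d>0. \<forall>h. norm h < d \<longrightarrow>
      mlin_norm i whole_sp real_sp (F (x + h) - F x - curry_last B h) \<le> e * norm h" if "e > 0" for e
    using deriv two_normed_carriers.has_fderiv_along_iff[OF whole.two_normed_forms, of F i x "curry_last B"] F that
    by auto
  have "\<exists>d>0. \<forall>h\<in>range R. nrm (range_sp R) h < d \<longrightarrow>
      mlin_norm i (range_sp R) real_sp (?p i (F (x + h)) - ?p i (F x) - curry_last (?p (Suc i) B) h)
        \<le> e * nrm (range_sp R) h" if "e > 0" for e
  proof -
    \<comment> \<open>restricting the \<open>i\<close> arguments of the form costs \<open>K ^ i\<close>, and the direction \<open>h\<close> one more \<open>K\<close>\<close>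
    have "e / (K ^ i * K) > 0" using that K_pos by simp
    then obtain d where d: "d > 0" "\<And>h. norm h < d \<Longrightarrow>
        mlin_norm i whole_sp real_sp (F (x + h) - F x - curry_last B h) \<le> e / (K ^ i * K) * norm h"
      using expand by blast
    have "mlin_norm i (range_sp R) real_sp (?p i (F (x + h)) - ?p i (F x) - curry_last (?p (Suc i) B) h)
        \<le> e * nrm (range_sp R) h" if h: "h \<in> range R" "nrm (range_sp R) h < d / K" for h
    proof -
      have "norm h < d"
        using norm_le_nrm_range[OF h(1)] h(2) K_pos by (simp add: field_simps)
      have eq: "?p i (F (x + h)) - ?p i (F x) - curry_last (?p (Suc i) B) h = ?p i (F (x + h) - F x - curry_last B h)"
        using h(1) by (simp add: restrict.curry_last_pull restrict.pull_diff)
      have "mlin_norm i (range_sp R) real_sp (?p i (F (x + h) - F x - curry_last B h)) \<le> K ^ i * mlin_norm i whole_sp real_sp (F (x + h) - F x - curry_last B h)"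
        using restrict.mlin_norm_pull[of "F (x + h) - F x - curry_last B h" i]
        by (simp add: subspace_diff[OF whole_forms.subspace_mlin_maps] F curry_last_mem_mlin_maps[OF B])
      also have "\<dots> \<le> K ^ i * (e / (K ^ i * K) * (K * nrm (range_sp R) h))"
      proof (intro mult_left_mono)
        show "mlin_norm i whole_sp real_sp (F (x + h) - F x - curry_last B h) \<le> e / (K ^ i * K) * (K * nrm (range_sp R) h)"
          using d(2)[OF \<open>norm h < d\<close>] mult_left_mono[OF norm_le_nrm_range[OF h(1)], of "e / (K ^ i * K)"] \<open>e > 0\<close> K_pos
          by (simp del: nrm_range_sp)
      qed (use K_pos in simp)
      also have "\<dots> = e * nrm (range_sp R) h" using K_pos by simp
      finally show ?thesis unfolding eq .
    qed
    moreover have "d / K > 0" using d(1) K_pos by simp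
    ultimately show ?thesis by blast
  qed
  moreover have "curry_last (?p (Suc i) B) \<in> lin_maps (range_sp R) (mlin_sp i (range_sp R) real_sp)"
    by (intro range_forms.curry_last_mem_lin_maps restrict.pull_mem B)
  ultimately show ?thesis
    using two_normed_carriers.has_fderiv_along_iff[OF range.two_normed_forms,
        of "\<lambda>x. ?p i (F x)" i x "curry_last (?p (Suc i) B)"] restrict.pull_mem[OF F]
    by simp
qed

lemma fderiv_pow_range:
  assumes diff: "fdifferentiable_times whole_sp k f"
  shows "fdifferentiable_times (range_sp R) k f"
    and "fderiv_pow (range_sp R) k f = (\<lambda>x. pull k (range_sp R) (\<lambda>h. h) (\<lambda>r. r) (fderiv_pow whole_sp k f x))"
proof -
  have mem: "fderiv_pow whole_sp i f x \<in> mlin_maps i whole_sp real_sp" if "i \<le> k" for i x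
    using whole.fdifferentiable_times_mono[OF diff that] by (rule whole.fderiv_pow_mem)
  let ?E = "\<lambda>i x. pull i (range_sp R) (\<lambda>h. h) (\<lambda>r. r) (fderiv_pow whole_sp i f x)"
  have "fdifferentiable_times (range_sp R) k f \<and> fderiv_pow (range_sp R) k f = ?E k"
  proof (rule range.fderiv_pow_eqI)
    show "?E 0 x = const_map (f x)" for x
      by (auto simp: pull_def args_0 const_map_def)
    show "?E i x \<in> mlin_maps i (range_sp R) real_sp" if "i \<le> k" for i x
      by (intro restrict.pull_mem mem that)
    show "has_fderiv_along (range_sp R) (mlin_sp i (range_sp R) real_sp) (?E i) x (curry_last (?E (Suc i) x))"
      if "i < k" for i x
      using that whole.fdifferentiable_times_mono[OF diff, of "Suc i"]
      by (intro has_fderiv_along_restrict mem whole.has_fderiv_along_fderiv_pow) auto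
  qed
  then show "fdifferentiable_times (range_sp R) k f" "fderiv_pow (range_sp R) k f = ?E k"
    by simp_all
qed

text \<open>
  For \<open>h = R u\<close> with \<open>u\<close> orthogonal to the kernel, the inner product of \<open>R (R v)\<close> and \<open>h\<close> in
  \<open>range_sp R\<close> is \<open>R v \<bullet> u = v \<bullet> h\<close>: the square of \<open>R\<close> turns representation of forms in \<open>H\<close> into
  representation in \<open>range_sp R\<close>.
\<close>

lemma ip_range_R_R: "h \<in> range R \<Longrightarrow> ip (range_sp R) (R (R v)) h = v \<bullet> h"
  using symmetric_R[of v "R_inv R h"] by (simp add: R_inv_R range_orthogonal_ker R_R_inv)

lemma ip_range_nondegenerate:
  assumes "g \<in> range R" "g' \<in> range R" "\<And>h. h \<in> range R \<Longrightarrow> ip (range_sp R) g h = ip (range_sp R) g' h"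
  shows "g = g'"
proof -
  have "ip (range_sp R) (g - g') (g - g') = 0"
    using assms(3)[of "g - g'"] assms(1,2) range.diff_mem[of g g'] range.scaleR_mem[of g' "-1"]
      R_inv_add[of g "- g'"] R_inv_scaleR[of g' "-1"]
    by (simp add: inner_diff_left)
  then have "nrm (range_sp R) (g - g') = 0" by simp
  then have "g - g' = 0"
    using assms range.diff_mem by (intro range.nrm_eq_0D) auto
  then show ?thesis by simp
qed

lemma nabla_range:
  assumes diff: "fdifferentiable_times whole_sp (Suc k) f"
  shows "nabla (range_sp R) (Suc k) f x = pull k (range_sp R) (\<lambda>h. h) (\<lambda>v. R (R v)) (nabla whole_sp (Suc k) f x)"
proof (rule nabla_eqI)
  show "g = g'" if "g \<in> carr (range_sp R)" "g' \<in> carr (range_sp R)"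
    "\<And>h. h \<in> carr (range_sp R) \<Longrightarrow> ip (range_sp R) g h = ip (range_sp R) g' h" for g g'
    using that by (intro ip_range_nondegenerate) auto
  show "pull k (range_sp R) (\<lambda>h. h) (\<lambda>v. R (R v)) (nabla whole_sp (Suc k) f x) \<in> mlin_maps k (range_sp R) (range_sp R)"
    by (intro restrict_grad.pull_mem nabla_whole(1) diff)
  fix hs h assume hs: "hs \<in> args k (range_sp R)" "h \<in> carr (range_sp R)"
  then have "length hs = k" by (simp add: args_def)
  then show "fderiv_pow (range_sp R) (Suc k) f x (hs @ [h]) =
      ip (range_sp R) (pull k (range_sp R) (\<lambda>h. h) (\<lambda>v. R (R v)) (nabla whole_sp (Suc k) f x) hs) h"
    unfolding fderiv_pow_range(2)[OF diff]
    using hs by (simp add: pull_def args_snoc_iff nabla_whole(2)[OF diff] ip_range_R_R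
        del: fderiv_pow.simps ip_range_sp)
qed

lemma BUC_diff_range:
  assumes "f \<in> BUC_diff whole_sp k"
  shows "f \<in> BUC_diff (range_sp R) k"
proof -
  have diff: "fdifferentiable_times whole_sp k f" using assms by (simp add: BUC_diff_def)
  have "nabla (range_sp R) i f \<in> BUC (mlin_sp (i - 1) (range_sp R) (range_sp R))" if i: "i \<in> {1..k}" for i
  proof -
    obtain j where j: "i = Suc j" using i by (cases i) auto
    have "nabla whole_sp i f \<in> BUC (mlin_sp (i - 1) whole_sp whole_sp)"
      using assms i by (simp add: BUC_diff_def)
    then have "(\<lambda>x. pull j (range_sp R) (\<lambda>h. h) (\<lambda>v. R (R v)) (nabla whole_sp (Suc j) f x))
        \<in> BUC (mlin_sp j (range_sp R) (range_sp R))"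
      by (intro restrict_grad.BUC_pull) (simp add: j)
    moreover have "fdifferentiable_times whole_sp (Suc j) f"
      using whole.fdifferentiable_times_mono[OF diff, of "Suc j"] i j
      by (simp del: fdifferentiable_times.simps)
    then have "nabla (range_sp R) (Suc j) f =
        (\<lambda>x. pull j (range_sp R) (\<lambda>h. h) (\<lambda>v. R (R v)) (nabla whole_sp (Suc j) f x))"
      by (intro ext[where 'a = 'a] nabla_range)
    ultimately show ?thesis by (simp add: j)
  qed
  then show ?thesis
    using assms fderiv_pow_range(1)[OF diff] by (simp add: BUC_diff_def)
qed

section \<open>The \<open>R\<close>-derivatives\<close>

lemma has_R_grad_iff:
  "has_R_grad R f x l \<longleftrightarrow> (\<forall>v. ((\<lambda>s. (f (x + s *\<^sub>R R v) - f x) / s) \<longlongrightarrow> l \<bullet> v) (at 0))"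
  unfolding has_R_grad_def by (simp add: tendsto_rabs_zero_iff flip: LIM_zero_iff[where l = "_ \<bullet> _"])

lemma R_grad_eqI:
  assumes "has_R_grad R f x l"
  shows "R_grad R f x = l"
  unfolding R_grad_def
proof (rule the_equality[where P = "has_R_grad R f x", OF assms])
  fix l' assume "has_R_grad R f x l'"
  then have "l' \<bullet> v = l \<bullet> v" for v
    using assms tendsto_unique[OF at_neq_bot] unfolding has_R_grad_iff by blast
  then show "l' = l" by (rule vector_eq_inner)
qed

lemma has_R_deriv_unique:
  assumes F: "\<And>x. F x \<in> mlin_maps k whole_sp whole_sp"
    and B: "has_R_deriv R (Suc k) F x B" "has_R_deriv R (Suc k) F x B'"
  shows "B = B'"
proof (rule mlin_maps_ext)
  show mem: "B \<in> mlin_maps (Suc k) whole_sp whole_sp" "B' \<in> mlin_maps (Suc k) whole_sp whole_sp"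
    using B by (simp_all add: has_R_deriv_def)
  fix hs :: "'a list" assume "hs \<in> args (Suc k) whole_sp"
  then obtain gs v where hs: "hs = gs @ [v]" by (auto simp: args_Suc)
  define q where "q B s = (1 / s) *\<^sub>R (F (x + s *\<^sub>R R v) - F x) - curry_last B v" for B s
  have cmem: "curry_last B v \<in> mlin_maps k whole_sp whole_sp" "curry_last B' v \<in> mlin_maps k whole_sp whole_sp"
    using mem by (auto intro: curry_last_mem_mlin_maps)
  have qmem: "q B s \<in> mlin_maps k whole_sp whole_sp" "q B' s \<in> mlin_maps k whole_sp whole_sp" for s
    unfolding q_def
    by (intro subspace_diff[OF whole_maps.subspace_mlin_maps] subspace_scale[OF whole_maps.subspace_mlin_maps] F cmem)+
  let ?n = "mlin_norm k whole_sp (whole_sp :: 'a hilbert_sp)"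
  have "((\<lambda>s. ?n (q B s)) \<longlongrightarrow> 0) (at 0)" "((\<lambda>s. ?n (q B' s)) \<longlongrightarrow> 0) (at 0)"
    using B by (simp_all add: has_R_deriv_def q_def curry_last_def)
  then have "((\<lambda>s. ?n (q B' s) + ?n (q B s)) \<longlongrightarrow> 0 + 0) (at 0)"
    by (intro tendsto_add)
  moreover have "?n (curry_last B v - curry_last B' v) \<le> ?n (q B' s) + ?n (q B s)" for s
    using whole_maps.mlin.nrm_triangle_diff[of "q B' s" k "q B s"] qmem[of s] by (simp add: q_def)
  ultimately have "?n (curry_last B v - curry_last B' v) \<le> 0 + 0"
    by (intro tendsto_lowerbound[of _ _ "at (0::real)"]) auto
  then have "?n (curry_last B v - curry_last B' v) = 0"
    using whole_maps.mlin_norm_nonneg[OF subspace_diff[OF whole_maps.subspace_mlin_maps cmem]] by simp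
  then have "curry_last B v - curry_last B' v = 0"
    by (rule whole_maps.mlin_norm_eq_0D[OF subspace_diff[OF whole_maps.subspace_mlin_maps cmem]])
  then show "B hs = B' hs"
    by (simp add: hs curry_last_def fun_eq_iff)
qed

text \<open>
  Paired with \<open>w\<close>, the difference quotient of the \<open>R\<close>-gradient is the difference quotient of the
  derivative of order \<open>k + 1\<close> with \<open>R w\<close> in its last place, so its limit has the new direction
  \<open>R v\<close> after \<open>R w\<close>. In the candidate for the limit \<open>R w\<close> comes after \<open>R v\<close>. The symmetry of the
  last two directions reconciles the two.
\<close>

lemma has_R_deriv_nabla:
  assumes f: "f \<in> BUC_diff whole_sp (Suc (Suc k))"
  shows "has_R_deriv R (Suc k) (\<lambda>x. pull k whole_sp R R (nabla whole_sp (Suc k) f x)) x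
    (pull (Suc k) whole_sp R R (nabla whole_sp (Suc (Suc k)) f x))"
proof -
  have diff: "fdifferentiable_times whole_sp (Suc (Suc k)) f"
    using f by (simp add: BUC_diff_def del: fdifferentiable_times.simps)
  have diff': "fdifferentiable_times whole_sp (Suc k) f" using diff by simp
  let ?D = "fderiv_pow whole_sp (Suc k) f" and ?D2 = "fderiv_pow whole_sp (Suc (Suc k)) f x"
  let ?S = "\<lambda>x. pull k whole_sp R R (nabla whole_sp (Suc k) f x)"
  let ?B = "pull (Suc k) whole_sp R R (nabla whole_sp (Suc (Suc k)) f x)"
  have S: "?S y \<in> mlin_maps k whole_sp whole_sp" for y
    by (intro subst_grad.pull_mem nabla_whole(1)[OF diff'])
  have B: "?B \<in> mlin_maps (Suc k) whole_sp whole_sp"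
    by (intro subst_grad.pull_mem nabla_whole(1)[OF diff])
  have "((\<lambda>s. mlin_norm k whole_sp whole_sp ((1 / s) *\<^sub>R (?S (x + s *\<^sub>R R v) - ?S x) - curry_last ?B v)) \<longlongrightarrow> 0) (at 0)"
    for v
  proof -
    define P where "P s = (1 / s) *\<^sub>R (?S (x + s *\<^sub>R R v) - ?S x) - curry_last ?B v" for s
    define Q where "Q s = (1 / s) *\<^sub>R (?D (x + s *\<^sub>R R v) - ?D x) - curry_last ?D2 (R v)" for s
    have P: "P s \<in> mlin_maps k whole_sp whole_sp" for s
      unfolding P_def
      by (intro subspace_diff[OF whole_maps.subspace_mlin_maps] subspace_scale[OF whole_maps.subspace_mlin_maps]
          S curry_last_mem_mlin_maps[OF B]) simp
    have Q: "Q s \<in> mlin_maps (Suc k) whole_sp real_sp" for s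
      unfolding Q_def
      by (intro subspace_diff[OF whole_forms.subspace_mlin_maps] subspace_scale[OF whole_forms.subspace_mlin_maps]
          whole.fderiv_pow_mem[OF diff'] curry_last_mem_mlin_maps[OF whole.fderiv_pow_mem[OF diff]]) simp
    have PQ: "P s hs \<bullet> w = pull (Suc k) whole_sp R (\<lambda>r. r) (Q s) (hs @ [w])" if hs: "length hs = k" for s hs w
    proof -
      have S_eq: "?S y hs \<bullet> w = ?D y (map R hs @ [R w])" for y
        using hs nabla_whole(2)[OF diff', of "map R hs" y "R w"] by (simp add: pull_def symmetric_R del: fderiv_pow.simps)
      have "curry_last ?B v hs \<bullet> w = ?D2 ((map R hs @ [R v]) @ [R w])"
        using hs nabla_whole(2)[OF diff, of "map R hs @ [R v]" x "R w"]
        by (simp add: pull_def curry_last_def symmetric_R del: fderiv_pow.simps)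
      also have "\<dots> = ?D2 (map R hs @ [R w, R v])"
        using fderiv_pow_swap_last[OF f, of "map R hs" x "R v" "R w"] hs by (simp del: fderiv_pow.simps)
      finally show ?thesis
        using hs S_eq
        by (simp add: P_def Q_def pull_def scaleR_fun_def inner_diff_left curry_last_def del: fderiv_pow.simps)
    qed
    have "mlin_norm k whole_sp whole_sp (P s) \<le> K ^ Suc k * mlin_norm (Suc k) whole_sp real_sp (Q s)" for s
      using mlin_norm_le_of_inner[OF subst_form.pull_mem[OF Q] PQ, of s] subst_form.mlin_norm_pull[OF Q, of s]
      by simp
    then have le: "norm (mlin_norm k whole_sp whole_sp (P s)) \<le> K ^ Suc k * mlin_norm (Suc k) whole_sp real_sp (Q s)" for s
      using whole_maps.mlin_norm_nonneg[OF P, of s] by simp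
    have lim: "((\<lambda>s. K ^ Suc k * mlin_norm (Suc k) whole_sp real_sp (Q s)) \<longlongrightarrow> 0) (at 0)"
      unfolding Q_def by (rule tendsto_mult_right_zero[OF fderiv_pow_difference_quotient[OF diff]])
    have "((\<lambda>s. mlin_norm k whole_sp whole_sp (P s)) \<longlongrightarrow> 0) (at 0)"
      by (rule Lim_null_comparison[OF _ lim], rule always_eventually, rule allI, rule le)
    then show ?thesis by (simp add: P_def)
  qed
  then show ?thesis using B by (simp add: has_R_deriv_def curry_last_def)
qed

lemma R_nabla_eq:
  assumes "f \<in> BUC_diff whole_sp (Suc k)"
  shows "R_differentiable_times R (Suc k) f \<and>
    R_nabla R (Suc k) f = (\<lambda>x. pull k whole_sp R R (nabla whole_sp (Suc k) f x))"
  using assms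
proof (induction k)
  case 0
  then have diff: "fdifferentiable_times whole_sp (Suc 0) f"
    by (simp add: BUC_diff_def del: fdifferentiable_times.simps)
  have grad: "has_R_grad R f x (R (nabla whole_sp (Suc 0) f x []))" for x
    unfolding has_R_grad_iff
  proof
    fix v
    have "((\<lambda>s. fderiv_pow whole_sp 0 f (x + s *\<^sub>R R v) []) has_real_derivative
        fderiv_pow whole_sp (Suc 0) f x ([] @ [R v])) (at 0)"
      by (rule fderiv_pow_has_real_derivative[OF diff]) simp
    then show "((\<lambda>s. (f (x + s *\<^sub>R R v) - f x) / s) \<longlongrightarrow> R (nabla whole_sp (Suc 0) f x []) \<bullet> v) (at 0)"
      unfolding nabla_whole(2)[OF diff list.size(3)]
      by (simp add: has_field_derivative_iff const_map_def symmetric_R)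
  qed
  have "R_nabla R (Suc 0) f x = pull 0 whole_sp R R (nabla whole_sp (Suc 0) f x)" for x
    using R_grad_eqI[OF grad[of x]] by (auto simp: const_map_def pull_def)
  then show ?case using grad by auto
next
  case (Suc k)
  have fk: "f \<in> BUC_diff whole_sp (Suc k)" using Suc.prems by (auto simp: BUC_diff_def)
  then have diff: "fdifferentiable_times whole_sp (Suc k) f"
    by (simp add: BUC_diff_def del: fdifferentiable_times.simps)
  have IH: "R_differentiable_times R (Suc k) f"
    "R_nabla R (Suc k) f = (\<lambda>x. pull k whole_sp R R (nabla whole_sp (Suc k) f x))"
    using Suc.IH[OF fk] by simp_all
  have mem: "R_nabla R (Suc k) f x \<in> mlin_maps k whole_sp whole_sp" for x
    unfolding IH by (intro subst_grad.pull_mem nabla_whole(1)[OF diff])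
  have deriv: "has_R_deriv R (Suc k) (R_nabla R (Suc k) f) x
      (pull (Suc k) whole_sp R R (nabla whole_sp (Suc (Suc k)) f x))" for x
    unfolding IH by (rule has_R_deriv_nabla[OF Suc.prems])
  have unique: "\<exists>!B. has_R_deriv R (Suc k) (R_nabla R (Suc k) f) x B" for x
  proof (rule ex1I)
    show "has_R_deriv R (Suc k) (R_nabla R (Suc k) f) x
        (pull (Suc k) whole_sp R R (nabla whole_sp (Suc (Suc k)) f x))"
      by (rule deriv)
    then show "B = pull (Suc k) whole_sp R R (nabla whole_sp (Suc (Suc k)) f x)"
      if "has_R_deriv R (Suc k) (R_nabla R (Suc k) f) x B" for B
      using that by (intro has_R_deriv_unique[where F = "R_nabla R (Suc k) f" and k = k and x = x] mem)
  qed
  have "R_nabla R (Suc (Suc k)) f x = pull (Suc k) whole_sp R R (nabla whole_sp (Suc (Suc k)) f x)" for x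
    unfolding R_nabla.simps(3) by (rule the1_equality[OF unique]) (rule deriv)
  then show ?case using IH(1) unique by auto
qed

lemma BUC_R_of_BUC_diff:
  assumes "f \<in> BUC_diff whole_sp (Suc k)"
  shows "f \<in> BUC_R R (Suc k)"
proof -
  have "R_nabla R i f \<in> BUC (mlin_sp (i - 1) whole_sp whole_sp)" if i: "i \<in> {1..Suc k}" for i
  proof -
    obtain j where j: "i = Suc j" using i by (cases i) auto
    have diff: "fdifferentiable_times whole_sp (Suc k) f"
      using assms by (simp add: BUC_diff_def del: fdifferentiable_times.simps)
    have "f \<in> BUC_diff whole_sp (Suc j)"
      using assms i j whole.fdifferentiable_times_mono[OF diff, of "Suc j"]
      by (auto simp: BUC_diff_def simp del: fdifferentiable_times.simps)
    moreover have "nabla whole_sp i f \<in> BUC (mlin_sp (i - 1) whole_sp whole_sp)"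
      using assms i by (simp add: BUC_diff_def)
    ultimately show ?thesis
      using R_nabla_eq[of f j] subst_grad.BUC_pull[of "nabla whole_sp (Suc j) f" j] by (simp add: j)
  qed
  then show ?thesis
    using assms R_nabla_eq[OF assms] by (simp add: BUC_R_def BUC_diff_def)
qed

end

theorem theorem2p22:
  fixes R :: "'a::{real_inner, complete_space} \<Rightarrow> 'a"
    and \<phi> :: "'a \<Rightarrow> real"
    and k :: nat
  assumes "separable_space (euclidean :: 'a topology)"
    and "bounded_linear R"
    and "\<forall>x y. R x \<bullet> y = x \<bullet> R y"
    and "k \<ge> 1"
    and "\<phi> \<in> BUC_diff whole_sp k"
  shows "\<phi> \<in> BUC_R R k \<and>
    \<phi> \<in> BUC_diff (range_sp R) k \<and>
    (k \<ge> 2 \<longrightarrow> (\<forall>x.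
       (\<forall>hs. length hs = k - 1 \<and> set hs \<subseteq> carr (range_sp R) \<longrightarrow>
          nabla (range_sp R) k \<phi> x hs = R (R (nabla whole_sp k \<phi> x hs))) \<and>
       (\<forall>vs. length vs = k - 1 \<longrightarrow>
          R_nabla R k \<phi> x vs = R (nabla whole_sp k \<phi> x (map R vs))))) \<and>
    (k = 1 \<longrightarrow> (\<forall>x.
       grad (range_sp R) \<phi> x = R (R (grad whole_sp \<phi> x)) \<and>
       R_grad R \<phi> x = R (grad whole_sp \<phi> x)))"
proof -
  interpret selfadjoint R
    using assms(2,3) by (intro selfadjoint.intro) auto
  obtain j where j: "k = Suc j" using assms(4) by (cases k) auto
  have \<phi>: "\<phi> \<in> BUC_diff whole_sp (Suc j)" using assms(5) by (simp add: j)
  then have diff: "fdifferentiable_times whole_sp (Suc j) \<phi>"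
    by (simp add: BUC_diff_def del: fdifferentiable_times.simps)
  have range_eq: "nabla (range_sp R) k \<phi> x hs = R (R (nabla whole_sp k \<phi> x hs))"
    if "length hs = j" "set hs \<subseteq> carr (range_sp R)" for x hs
    using that nabla_range[OF diff, of x] by (simp add: j pull_def args_def)
  have R_eq: "R_nabla R k \<phi> x vs = R (nabla whole_sp k \<phi> x (map R vs))" if "length vs = j" for x vs
    using that R_nabla_eq[OF \<phi>] by (simp add: j pull_def)
  have "grad (range_sp R) \<phi> x = R (R (grad whole_sp \<phi> x)) \<and> R_grad R \<phi> x = R (grad whole_sp \<phi> x)"
    if "k = 1" for x
    using range_eq[of "[]" x] R_eq[of "[]" x] that j by (simp add: grad_def const_map_def)
  then show ?thesis
    using BUC_R_of_BUC_diff[OF \<phi>] BUC_diff_range[OF \<phi>] range_eq R_eq by (simp add: j)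
qed

end
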